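(* Assume: (A1) $\mathcal{X}\subseteq\mathbb{R}^d$ and $\Xi\subseteq\mathbb{R}^k$ are compact and bounded, $h$ is bounded on $\mathcal{X}\times\Xi$, and for every $\mathbf{x}\in\mathcal{X}$ there is a constant $c_p>0$ such that $|h(\mathbf{x},s_1)-h(\mathbf{x},s_2)|\le c_p\|s_1-s_2\|_p$ for all $s_1,s_2\in\Xi$; (A2) there is a constant $c_2\ge 0$ such that $d_W(Q(\mathbf{x}),Q(\mathbf{y}))\le c_2\, d_{\mathcal{X}}(\mathbf{x},\mathbf{y})$ for all $\mathbf{x},\mathbf{y}\in\mathcal{X}$. Then there exist constants $c_3,c_4>0$, independent of the dataset $\mathcal{D}$, such that for every dataset $\mathcal{D}$, every interpolation $\hat P_N(\cdot)$ of the empirical measures of $\mathcal{D}$ with Lipschitz constant $c_1\ge 0$, and every $\beta\in(0,1)$, if $$r_N=(c_1+c_2)\,r_{\mathcal{D}}+\left(\frac{b(\beta,c_3)}{c_4}\right)^{1/k},$$ then the ambiguity sets $\mathcal{P}(\mathbf{x})=\{P\in\mathcal{M}(\Xi,\mathcal{B}(\Xi)) : d_W(P,\hat P_N(\mathbf{x}))\le r_N\}$ satisfy $$\mathbb{P}\big(Q(\mathbf{x})\in\mathcal{P}(\mathbf{x})\ \text{ for all }\mathbf{x}\in\mathcal{X}\big)\ge 1-\beta .$$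
   Context: Setting. $\mathcal{X}\subseteq\mathbb{R}^d$ is the set of feasible decisions, equipped with a metric $d_{\mathcal{X}}$; $\Xi\subseteq\mathbb{R}^k$ is the set of values of the random parameter $\xi$; $h:\mathbb{R}^d\times\mathbb{R}^k\to\mathbb{R}\cup\{\pm\infty\}$ is the objective function. $\mathcal{M}(\Xi,\mathcal{B}(\Xi))$ is the set of all Borel probability measures on $\Xi$. For each $\mathbf{x}\in\mathcal{X}$, $Q(\mathbf{x})\in\mathcal{M}(\Xi,\mathcal{B}(\Xi))$ is the true (unknown) decision-dependent distribution of $\xi$. Wasserstein distance. Fix $p\ge1$. For $P_1,P_2\in\mathcal{M}(\Xi,\mathcal{B}(\Xi))$, $d_W(P_1,P_2)=\inf_{\gamma}\int_{\Xi\times\Xi}\|s_1-s_2\|_p\,\gamma(ds_1\times ds_2)$, the infimum being over all couplings $\gamma$ of $P_1$ and $P_2$ ($L_1$-Wasserstein distance with ground metric the $p$-norm). Data. The dataset is $\mathcal{D}=\{(\mathbf{x}_n,\xi_n)\}_{n\in[N]}$, $[N]=\{1,\dots,N\}$, where $\mathbf{x}_n\in\mathcal{X}$ are given decisions and the $\xi_n$ are independent with $\xi_n\sim Q(\mathbf{x}_n)$; $\mathbb{P}$ denotes probability over the samples $\xi_1,\dots,\xi_N$. Let $\{\mathbf{x}_{n_i}\}_{i\in[N_{\mathbf{x}}]}$ be the distinct values among the $\mathbf{x}_n$, let $N_i=\#\{n\in[N]:\mathbf{x}_n=\mathbf{x}_{n_i}\}$, and let $\mu_i=\frac1{N_i}\sum_{n:\,\mathbf{x}_n=\mathbf{x}_{n_i}}\delta_{\xi_n}$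 be the empirical measure at $\mathbf{x}_{n_i}$ ($\delta$ denotes a Dirac measure). Interpolation. An interpolation of the empirical measures with Lipschitz constant $c_1\ge0$ is a family $\hat P_N(\mathbf{x})=\sum_{i=1}^{N_{\mathbf{x}}}\omega_i(\mathbf{x})\mu_i$, $\mathbf{x}\in\mathcal{X}$, with weights satisfying $\omega_i(\mathbf{x})\ge0$ for all $i$ and $\mathbf{x}$, $\sum_{i=1}^{N_{\mathbf{x}}}\omega_i(\mathbf{x})=1$ for all $\mathbf{x}$, and $\omega_i(\mathbf{x}_{n_i})=1$ for all $i$, and such that for every $\mathbf{x}\in\mathcal{X}$ there is an index $i$ with $d_{\mathcal{X}}(\mathbf{x},\mathbf{x}_{n_i})=\min_{j\in[N_{\mathbf{x}}]}d_{\mathcal{X}}(\mathbf{x},\mathbf{x}_{n_j})$ and $d_W(\hat P_N(\mathbf{x}),\hat P_N(\mathbf{x}_{n_i}))\le c_1\min_{j\in[N_{\mathbf{x}}]}d_{\mathcal{X}}(\mathbf{x},\mathbf{x}_{n_j})$. Quantities in the radius. With $\mathcal{A}_r(\mathbf{x})=\{\mathbf{y}\in\mathcal{X}:d_{\mathcal{X}}(\mathbf{x},\mathbf{y})\le r\}$, the covering radius is $r_{\mathcal{D}}=\inf\{r>0:\mathcal{X}\subseteq\bigcup_{i\in[N_{\mathbf{x}}]}\mathcal{A}_r(\mathbf{x}_{n_i})\}$. For $\beta\in(0,1)$ and $c>0$, $b(\beta,c)=\inf\{t>0:\sum_{i=1}^{N_{\mathbf{x}}}\exp(-tN_i)<\beta/c\}$.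 The number $k$ is the dimension of $\xi$.
   Formalization: The formal theorem adds the hypothesis k ≥ 3: with exponent 1/k the claim is false for k = 1 (Ξ={0,1}, Q Bernoulli(1/2): true rate N^(-1/2), radius of order 1/N) and for k = 2 (uniform law on the square, rate sqrt(log N/N)). *)

theory Defs
  imports "HOL-Probability.Probability"
begin

definition pnorm :: "real \<Rightarrow> real ^ 'k \<Rightarrow> real" where
  "pnorm p v = (\<Sum>i\<in>UNIV. \<bar>v $ i\<bar> powr p) powr (1 / p)"

definition borel_probs :: "(real ^ 'k) set \<Rightarrow> (real ^ 'k) measure set" where
  "borel_probs \<Xi> = {P. prob_space P \<and> space P = \<Xi> \<and> sets P = sets (restrict_space borel \<Xi>)}"

definition couplings :: "'a measure \<Rightarrow> 'a measure \<Rightarrow> ('a \<times> 'a) measure set" where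
  "couplings P1 P2 =
     {\<gamma>. sets \<gamma> = sets (P1 \<Otimes>\<^sub>M P2) \<and> distr \<gamma> P1 fst = P1 \<and> distr \<gamma> P2 snd = P2}"

definition wdist :: "real \<Rightarrow> (real ^ 'k) measure \<Rightarrow> (real ^ 'k) measure \<Rightarrow> ennreal" where
  "wdist p P1 P2 =
     (INF \<gamma>\<in>couplings P1 P2. \<integral>\<^sup>+ z. ennreal (pnorm p (fst z - snd z)) \<partial>\<gamma>)"

text \<open>
  The measure \<open>\<Sum>i\<in>I. w i * \<mu> i\<close> on \<open>\<Xi>\<close>; the lemma below shows that \<^const>\<open>measure_of\<close>
  does not fall back to its default value here.
\<close>

definition mixture ::
  "(real ^ 'k) set \<Rightarrow> 'i set \<Rightarrow> ('i \<Rightarrow> real) \<Rightarrow> ('i \<Rightarrow> (real ^ 'k) measure) \<Rightarrow> (real ^ 'k) measure"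
where
  "mixture \<Xi> I w \<mu> =
     measure_of \<Xi> (sets (restrict_space borel \<Xi>)) (\<lambda>A. \<Sum>i\<in>I. ennreal (w i) * emeasure (\<mu> i) A)"

lemma space_mixture [simp]: "space (mixture \<Xi> I w \<mu>) = \<Xi>"
  and sets_mixture [simp]: "sets (mixture \<Xi> I w \<mu>) = sets (restrict_space borel \<Xi>)"
proof -
  have 1: "space (restrict_space borel \<Xi>) = \<Xi>"
    by (simp add: space_restrict_space)
  have 2: "sets (restrict_space borel \<Xi>) \<subseteq> Pow \<Xi>"
    using sets.space_closed[of "restrict_space borel \<Xi>"] 1 by simp
  show "space (mixture \<Xi> I w \<mu>) = \<Xi>"
    unfolding mixture_def using 2 by (rule space_measure_of)
  show "sets (mixture \<Xi> I w \<mu>) = sets (restrict_space borel \<Xi>)"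
    unfolding mixture_def using 2 1 sets.sigma_sets_eq[of "restrict_space borel \<Xi>"]
    by (simp add: sets_measure_of)
qed

lemma emeasure_mixture:
  assumes sets: "\<And>i. i \<in> I \<Longrightarrow> sets (\<mu> i) = sets (restrict_space borel \<Xi>)"
    and A: "A \<in> sets (restrict_space borel \<Xi>)"
  shows "emeasure (mixture \<Xi> I w \<mu>) A = (\<Sum>i\<in>I. ennreal (w i) * emeasure (\<mu> i) A)"
proof (rule emeasure_measure_of[OF mixture_def])
  show "sets (restrict_space borel \<Xi>) \<subseteq> Pow \<Xi>"
    using sets.space_closed[of "restrict_space borel \<Xi>"] by (simp add: space_restrict_space)
  show "A \<in> sets (mixture \<Xi> I w \<mu>)" using A by simp
  show "positive (sets (mixture \<Xi> I w \<mu>)) (\<lambda>A. \<Sum>i\<in>I. ennreal (w i) * emeasure (\<mu> i) A)"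
    by (simp add: positive_def)
  show "countably_additive (sets (mixture \<Xi> I w \<mu>)) (\<lambda>A. \<Sum>i\<in>I. ennreal (w i) * emeasure (\<mu> i) A)"
  proof (rule countably_additiveI)
    fix F :: "nat \<Rightarrow> (real ^ 'b) set"
    assume F: "range F \<subseteq> sets (mixture \<Xi> I w \<mu>)" "disjoint_family F"
    have "(\<Sum>j. \<Sum>i\<in>I. ennreal (w i) * emeasure (\<mu> i) (F j)) =
          (\<Sum>i\<in>I. \<Sum>j. ennreal (w i) * emeasure (\<mu> i) (F j))"
      by (rule suminf_sum) simp
    also have "\<dots> = (\<Sum>i\<in>I. ennreal (w i) * emeasure (\<mu> i) (\<Union> (range F)))"
    proof (rule sum.cong[OF refl])
      fix i assume "i \<in> I"
      then have "range F \<subseteq> sets (\<mu> i)" using F(1) sets by simp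
      then show "(\<Sum>j. ennreal (w i) * emeasure (\<mu> i) (F j)) =
          ennreal (w i) * emeasure (\<mu> i) (\<Union> (range F))"
        using F(2) by (simp add: suminf_emeasure)
    qed
    finally show "(\<Sum>j. \<Sum>i\<in>I. ennreal (w i) * emeasure (\<mu> i) (F j)) =
      (\<Sum>i\<in>I. ennreal (w i) * emeasure (\<mu> i) (\<Union> (range F)))" .
  qed
qed

text \<open>
  A dataset consists of \<open>N\<close>, decisions \<open>x 1, \<dots>, x N\<close> and samples \<open>s 1, \<dots>, s N\<close>. The distinct
  decisions are indexed by themselves, i.e. by the set \<open>x ` {1..N}\<close>, rather than by an enumeration.
\<close>

definition mult_at :: "nat \<Rightarrow> (nat \<Rightarrow> 'x) \<Rightarrow> 'x \<Rightarrow> nat" where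
  "mult_at N x y = card {n \<in> {1..N}. x n = y}"

definition empirical ::
  "(real ^ 'k) set \<Rightarrow> nat \<Rightarrow> (nat \<Rightarrow> 'x) \<Rightarrow> (nat \<Rightarrow> real ^ 'k) \<Rightarrow> 'x \<Rightarrow> (real ^ 'k) measure"
where
  "empirical \<Xi> N x s y =
     mixture \<Xi> {n \<in> {1..N}. x n = y} (\<lambda>_. 1 / real (mult_at N x y))
       (\<lambda>n. return (restrict_space borel \<Xi>) (s n))"

definition is_interpolation ::
  "'x set \<Rightarrow> ('x \<Rightarrow> 'x \<Rightarrow> real) \<Rightarrow> (real ^ 'k) set \<Rightarrow> real \<Rightarrow> nat \<Rightarrow> (nat \<Rightarrow> 'x) \<Rightarrow>
   (nat \<Rightarrow> real ^ 'k) \<Rightarrow> real \<Rightarrow> ('x \<Rightarrow> (real ^ 'k) measure) \<Rightarrow> bool"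
where
  "is_interpolation X dX \<Xi> p N x s c1 Phat \<longleftrightarrow>
     0 \<le> c1 \<and>
     (\<exists>w :: 'x \<Rightarrow> 'x \<Rightarrow> real.
        (\<forall>y\<in>x ` {1..N}. \<forall>z\<in>X. 0 \<le> w y z) \<and>
        (\<forall>z\<in>X. (\<Sum>y\<in>x ` {1..N}. w y z) = 1) \<and>
        (\<forall>y\<in>x ` {1..N}. w y y = 1) \<and>
        (\<forall>z\<in>X. Phat z = mixture \<Xi> (x ` {1..N}) (\<lambda>y. w y z) (empirical \<Xi> N x s))) \<and>
     (\<forall>z\<in>X. \<exists>y\<in>x ` {1..N}.
        dX z y = Min (dX z ` x ` {1..N}) \<and>
        wdist p (Phat z) (Phat y) \<le> ennreal (c1 * Min (dX z ` x ` {1..N})))"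

text \<open>
  The covering radius is extended-valued: the metric on \<open>X\<close> need not be related to the Euclidean
  topology, so the set of admissible radii may be empty, and then the radius is \<open>\<infinity>\<close>.
\<close>

definition covering_radius ::
  "'x set \<Rightarrow> ('x \<Rightarrow> 'x \<Rightarrow> real) \<Rightarrow> nat \<Rightarrow> (nat \<Rightarrow> 'x) \<Rightarrow> ennreal"
where
  "covering_radius X dX N x =
     (INF r\<in>{r. 0 < r \<and> X \<subseteq> (\<Union>y\<in>x ` {1..N}. Metric_space.mcball X dX y r)}. ennreal r)"

definition conf_b :: "nat \<Rightarrow> (nat \<Rightarrow> 'x) \<Rightarrow> real \<Rightarrow> real \<Rightarrow> real" where
  "conf_b N x \<beta> c =
     Inf {t. 0 < t \<and> (\<Sum>y\<in>x ` {1..N}. exp (- t * real (mult_at N x y))) < \<beta> / c}"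

definition ambiguity_set ::
  "(real ^ 'k) set \<Rightarrow> real \<Rightarrow> ennreal \<Rightarrow> (real ^ 'k) measure \<Rightarrow> (real ^ 'k) measure set"
where
  "ambiguity_set \<Xi> p r P0 = {P \<in> borel_probs \<Xi>. wdist p P P0 \<le> r}"

text \<open>
  Joint law of independent samples \<open>s n\<close> with distribution \<open>Q (x n)\<close>, for \<open>n\<close> in \<open>{1..N}\<close>.
\<close>

definition sample_law ::
  "nat \<Rightarrow> (nat \<Rightarrow> 'x) \<Rightarrow> ('x \<Rightarrow> (real ^ 'k) measure) \<Rightarrow> (nat \<Rightarrow> real ^ 'k) measure"
where
  "sample_law N x Q = Pi\<^sub>M {1..N} (\<lambda>n. Q (x n))"

end

theory Submission
  imports Defs
begin

text \<open>
  Fix a decision \<open>z\<close> and let \<open>y\<close> be a nearest decision of the data at which the interpolation is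
  controlled. The triangle inequality gives
  \<open>W(Q z, Phat z) \<le> W(Q z, Q y) + W(Q y, \<mu> y) + W(\<mu> y, Phat z)\<close>, where \<open>\<mu> y = Phat y\<close> is the
  empirical measure at \<open>y\<close>. The outer terms are at most \<open>c2 * r\<close> and \<open>c1 * r\<close>, with \<open>r\<close> the covering
  radius. So it remains to find one event of probability at least \<open>1 - \<beta>\<close> on which \<open>W(\<mu> y, Q y)\<close> is
  at most the statistical part \<open>\<epsilon>\<close> of the radius for all of the finitely many \<open>y\<close> simultaneously
  (\<open>interpolation_error\<close>).
  
  The probabilistic core is \<open>empirical_concentration\<close>: for \<open>n\<close> independent samples of a distribution on
  a bounded subset of \<open>\<real>\<^sup>k\<close> with \<open>k \<ge> 3\<close>, there is an event on which \<open>W(\<mu>, Q) \<le> \<epsilon>\<close> and which fails with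
  probability at most \<open>3 * exp (- c4 * n * \<epsilon>\<^sup>k)\<close>. The quantity \<open>b = conf_b N x \<beta> 3\<close> is chosen so that the sum of these
  bounds over the data decisions, at \<open>c4 * \<epsilon>\<^sup>k = b\<close>, is at most \<open>\<beta>\<close>.
  
  For the concentration bound, a cube containing the support is divided into \<open>2\<^sup>k\<^sup>l\<close> cells at each
  level \<open>l \<le> L\<close>. Matching mass greedily from the finest level upwards costs, up to a constant
  factor, at most \<open>2\<^sup>-\<^sup>L\<close> plus the sum over \<open>l\<close> of \<open>2\<^sup>-\<^sup>l\<close> times the total variation distance of the two
  measures on the cells of level \<open>l + 1\<close> (\<open>multiscale_plan\<close>, \<open>wdist_le_dyadic_discrepancy\<close>). Such a distance is a maximum,
  over the sets of cells, of a difference of probabilities. Hence Hoeffding's inequality and a union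
  bound over the \<open>2 ^ 2\<^sup>k\<^sup>l\<close> sets of cells control it. With \<open>2\<^sup>-\<^sup>L\<close> of the order of \<open>\<epsilon>\<close> and
  deviations \<open>(3/8) ^ (L - l)\<close> at level \<open>l\<close>, the transport costs add up geometrically, and the
  Hoeffding exponents dominate the number of sets of cells exactly because \<open>k \<ge> 3\<close>
  (\<open>level_tail_bound\<close>). The good event is described by the empirical masses of finitely many sets,
  which makes it measurable.
  
  All couplings are reduced to finite tables. A partition into finitely many cells turns a coupling into
  a table of cell masses, and a table with the right marginals is turned back into a coupling by spreading
  each entry as a product measure (\<open>coupling_finite_plan\<close>, \<open>wdist_le_plan_cost\<close>). Couplings can thus
  be glued at a common marginal cell by cell, which gives the triangle inequality (\<open>wdist_triangle\<close>).
\<close>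

section \<open>The p-norm\<close>

lemma pnorm_zero: "pnorm p 0 = 0" by (simp add: pnorm_def)

lemma pnorm_nonneg: "0 \<le> pnorm p v" by (simp add: pnorm_def)

lemma pnorm_commute: "pnorm p (u - v) = pnorm p (v - u)"
  by (simp add: pnorm_def abs_minus_commute)

lemma measurable_pnorm [measurable]: "pnorm p \<in> borel_measurable borel"
  unfolding pnorm_def by measurable

lemma pnorm_powr:
  assumes "1 \<le> p"
  shows "pnorm p v powr p = (\<Sum>i\<in>UNIV. \<bar>v $ i\<bar> powr p)"
  using assms by (simp add: pnorm_def powr_powr sum_nonneg)

text \<open>
  The factor \<open>CARD('k)\<close> is larger than the optimal \<open>CARD('k) powr (1/p)\<close>, but does not depend on \<open>p\<close>.
\<close>

lemma pnorm_le_card: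
  fixes v :: "real ^ 'k"
  assumes p: "1 \<le> p" and v: "\<And>i. \<bar>v $ i\<bar> \<le> e"
  shows "pnorm p v \<le> real CARD('k) * e"
proof -
  have e: "0 \<le> e" using v[of undefined] by linarith
  have "(\<Sum>i\<in>UNIV. \<bar>v $ i\<bar> powr p) \<le> (\<Sum>i\<in>(UNIV::'k set). e powr p)"
    using p v by (intro sum_mono powr_mono2) auto
  also have "\<dots> = real CARD('k) powr 1 * e powr p" by simp
  also have "\<dots> \<le> real CARD('k) powr p * e powr p"
    using p by (intro mult_right_mono powr_mono) (auto simp: Suc_le_eq)
  also have "\<dots> = (real CARD('k) * e) powr p" using e by (simp add: powr_mult)
  finally have "(\<Sum>i\<in>UNIV. \<bar>v $ i\<bar> powr p) powr (1/p) \<le> ((real CARD('k) * e) powr p) powr (1/p)"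
    using p by (intro powr_mono2 sum_nonneg) auto
  also have "\<dots> = real CARD('k) * e" using p e by (simp add: powr_powr)
  finally show ?thesis by (simp add: pnorm_def)
qed

text \<open>
  Convexity up to the boundary point \<open>0\<close>: if an argument or a weight vanishes, the claim
  reduces to \<open>c powr p \<le> c\<close> for \<open>c\<close> in the unit interval.
\<close>

lemma powr_convex_combination:
  fixes x y a b p :: real
  assumes p: "1 \<le> p" and a: "0 \<le> a" "0 \<le> b" "a + b = 1" and xy: "0 \<le> x" "0 \<le> y"
  shows "(a * x + b * y) powr p \<le> a * x powr p + b * y powr p"
proof (cases "x = 0 \<or> y = 0 \<or> a = 0 \<or> b = 0")
  case False
  then show ?thesis
    using convex_onD[OF powr_convex[OF p], of b x y] assms
    by (auto simp: eq_diff_eq[symmetric])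
next
  case True
  have shrink: "c powr p \<le> c" if "0 \<le> c" "c \<le> 1" for c :: real
    using that p powr_mono'[of 1 p c] by simp
  have "(a * x) powr p \<le> a * x powr p" "(b * y) powr p \<le> b * y powr p"
    using a xy shrink[of a] shrink[of b] by (auto simp: powr_mult intro!: mult_right_mono)
  with True show ?thesis by auto
qed

text \<open>
  Minkowski's inequality: for \<open>a = pnorm p u\<close> and \<open>b = pnorm p v\<close>, the vector \<open>(u + v) / (a + b)\<close>
  is a convex combination of the unit vectors \<open>u / a\<close> and \<open>v / b\<close>, and the \<open>p\<close>-th power of the norm is convex.
\<close>

lemma pnorm_triangle:
  assumes p: "1 \<le> p"
  shows "pnorm p (u + v) \<le> pnorm p u + pnorm p v"
proof -
  have null: "w = 0" if "pnorm p w = 0" for w :: "real ^ 'k"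
  proof -
    have "(\<Sum>i\<in>UNIV. \<bar>w $ i\<bar> powr p) = 0" using that pnorm_powr[OF p, of w] by simp
    then show ?thesis by (subst (asm) sum_nonneg_eq_0_iff) (auto simp: vec_eq_iff)
  qed
  define a b where "a = pnorm p u" and "b = pnorm p v"
  show ?thesis
  proof (cases "a = 0 \<or> b = 0")
    case True
    then show ?thesis using null[of u] null[of v] by (auto simp: a_def b_def pnorm_zero)
  next
    case False
    then have ab: "0 < a" "0 < b"
      using pnorm_nonneg[of p u] pnorm_nonneg[of p v] by (auto simp: a_def b_def)
    define t where "t = a / (a + b)"
    have t: "0 \<le> t" "0 \<le> 1 - t" using ab by (auto simp: t_def)
    have t_eq: "(a + b) * t = a" "(a + b) * (1 - t) = b" using ab by (auto simp: t_def field_simps)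
    have one: "(\<Sum>i\<in>UNIV. (\<bar>u $ i\<bar> / a) powr p) = 1" "(\<Sum>i\<in>UNIV. (\<bar>v $ i\<bar> / b) powr p) = 1"
      using ab pnorm_powr[OF p, of u] pnorm_powr[OF p, of v]
      by (auto simp: powr_divide sum_divide_distrib[symmetric] a_def[symmetric] b_def[symmetric])
    have "(\<Sum>i\<in>UNIV. \<bar>(u + v) $ i\<bar> powr p)
        \<le> (\<Sum>i\<in>UNIV. (a + b) powr p * (t * (\<bar>u $ i\<bar> / a) powr p + (1 - t) * (\<bar>v $ i\<bar> / b) powr p))"
    proof (rule sum_mono)
      fix i
      have "(a + b) * (t * x) = ((a + b) * t) * x" "(a + b) * ((1 - t) * x) = ((a + b) * (1 - t)) * x" for x
        by (simp_all only: mult.assoc)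
      note s = this
      have "\<bar>(u + v) $ i\<bar> \<le> \<bar>u $ i\<bar> + \<bar>v $ i\<bar>" by simp
      also have "\<dots> = (a + b) * (t * (\<bar>u $ i\<bar> / a) + (1 - t) * (\<bar>v $ i\<bar> / b))"
        unfolding distrib_left s t_eq using ab by simp
      finally have "\<bar>(u + v) $ i\<bar> powr p
          \<le> ((a + b) * (t * (\<bar>u $ i\<bar> / a) + (1 - t) * (\<bar>v $ i\<bar> / b))) powr p"
        using p by (intro powr_mono2) auto
      also have "\<dots> = (a + b) powr p * (t * (\<bar>u $ i\<bar> / a) + (1 - t) * (\<bar>v $ i\<bar> / b)) powr p"
        using ab t by (intro powr_mult)
      also have "\<dots> \<le> (a + b) powr p * (t * (\<bar>u $ i\<bar> / a) powr p + (1 - t) * (\<bar>v $ i\<bar> / b) powr p)"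
        using ab t p by (intro mult_left_mono powr_convex_combination) auto
      finally show "\<bar>(u + v) $ i\<bar> powr p \<le> \<dots>" .
    qed
    also have "\<dots> = (a + b) powr p"
      using one by (simp add: sum_distrib_left[symmetric] sum.distrib)
    finally have "(\<Sum>i\<in>UNIV. \<bar>(u + v) $ i\<bar> powr p) powr (1/p) \<le> ((a + b) powr p) powr (1/p)"
      using p by (intro powr_mono2 sum_nonneg) auto
    also have "\<dots> = a + b" using p ab by (simp add: powr_powr)
    finally show ?thesis by (simp add: pnorm_def a_def b_def)
  qed
qed

section \<open>Transport plans on finite sets\<close>

text \<open>
  A table with row sums \<open>p\<close> and column sums \<open>q\<close>. The weights \<open>p\<close> and \<open>q\<close> may have any
  common total, because \<open>multiscale_plan\<close> transports leftover mass by such tables.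
\<close>

definition finite_plan :: "'a set \<Rightarrow> ('a \<Rightarrow> real) \<Rightarrow> ('a \<Rightarrow> real) \<Rightarrow> ('a \<Rightarrow> 'a \<Rightarrow> real) \<Rightarrow> bool" where
  "finite_plan A p q g \<longleftrightarrow> (\<forall>a\<in>A. \<forall>b\<in>A. 0 \<le> g a b) \<and>
     (\<forall>a\<in>A. (\<Sum>b\<in>A. g a b) = p a) \<and> (\<forall>b\<in>A. (\<Sum>a\<in>A. g a b) = q b)"

definition plan_cost :: "'a set \<Rightarrow> ('a \<Rightarrow> 'a \<Rightarrow> real) \<Rightarrow> ('a \<Rightarrow> 'a \<Rightarrow> real) \<Rightarrow> real" where
  "plan_cost A c g = (\<Sum>a\<in>A. \<Sum>b\<in>A. g a b * c a b)"

lemma finite_plan_le: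
  assumes "finite A" "finite_plan A p q g" "a \<in> A" "b \<in> A"
  shows "0 \<le> g a b" "g a b \<le> p a" "g a b \<le> q b"
  using assms member_le_sum[of b A "g a"] member_le_sum[of a A "\<lambda>a. g a b"]
  by (auto simp: finite_plan_def)

text \<open>
  The two plans are composed as conditionally independent given the common marginal, through the
  three-way table \<open>g1 a b * g2 c b / q b\<close>. Where \<open>q b = 0\<close> the columns of \<open>b\<close> in both plans vanish, in
  agreement with the value \<open>0\<close> of the quotient. Both plans lead to the common marginal, as the couplings in
  \<open>wdist_triangle\<close> do.
\<close>

lemma finite_plan_glue:
  assumes A: "finite A" and g1: "finite_plan A p q g1" and g2: "finite_plan A r q g2"
    and cost: "\<And>a b c. a \<in> A \<Longrightarrow> b \<in> A \<Longrightarrow> c \<in> A \<Longrightarrow> d a c \<le> e a b + e c b"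
  obtains g where "finite_plan A p r g" "plan_cost A d g \<le> plan_cost A e g1 + plan_cost A e g2"
proof -
  define f where "f a b c = g1 a b * g2 c b / q b" for a b c
  define g where "g a c = (\<Sum>b\<in>A. f a b c)" for a c
  have q: "0 \<le> q b" if "b \<in> A" for b
    using finite_plan_le(1,3)[OF A g1 that that] by linarith
  have f: "0 \<le> f a b c" if "a \<in> A" "b \<in> A" "c \<in> A" for a b c
    using finite_plan_le(1)[OF A g1] finite_plan_le(1)[OF A g2] q that by (simp add: f_def)
  have sum_c: "(\<Sum>c\<in>A. f a b c) = g1 a b" if "a \<in> A" "b \<in> A" for a b
  proof -
    have "(\<Sum>c\<in>A. f a b c) = g1 a b * (\<Sum>c\<in>A. g2 c b) / q b"
      by (simp add: f_def sum_distrib_left sum_divide_distrib)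
    then show ?thesis using that g2 finite_plan_le[OF A g1 that] by (auto simp: finite_plan_def)
  qed
  have sum_a: "(\<Sum>a\<in>A. f a b c) = g2 c b" if "c \<in> A" "b \<in> A" for c b
  proof -
    have "(\<Sum>a\<in>A. f a b c) = (\<Sum>a\<in>A. g1 a b) * g2 c b / q b"
      by (simp add: f_def sum_distrib_right sum_divide_distrib)
    then show ?thesis using that g1 finite_plan_le[OF A g2 that] by (auto simp: finite_plan_def)
  qed
  have sw: "(\<Sum>c\<in>A. \<Sum>b\<in>A. h b c) = (\<Sum>b\<in>A. \<Sum>c\<in>A. h b c)" for h :: "'a \<Rightarrow> 'a \<Rightarrow> real"
    by (rule sum.swap)
  have "finite_plan A p r g"
    using f g1 g2 sum_a sum_c unfolding finite_plan_def g_def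
    by (simp add: sum_nonneg sw[of "\<lambda>b c. f _ b c"] sum.swap[of "\<lambda>b a. f b a _" A A])
  moreover have "plan_cost A d g \<le> plan_cost A e g1 + plan_cost A e g2"
  proof -
    have "plan_cost A d g = (\<Sum>a\<in>A. \<Sum>b\<in>A. \<Sum>c\<in>A. f a b c * d a c)"
      unfolding plan_cost_def g_def sum_distrib_right by (intro sum.cong refl sw)
    also have "\<dots> \<le> (\<Sum>a\<in>A. \<Sum>b\<in>A. \<Sum>c\<in>A. f a b c * (e a b + e c b))"
      using f cost by (intro sum_mono mult_left_mono) auto
    also have "\<dots> = (\<Sum>a\<in>A. \<Sum>b\<in>A. (\<Sum>c\<in>A. f a b c) * e a b) + (\<Sum>a\<in>A. \<Sum>b\<in>A. \<Sum>c\<in>A. f a b c * e c b)"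
      by (simp add: distrib_left sum.distrib sum_distrib_right)
    also have "(\<Sum>a\<in>A. \<Sum>b\<in>A. (\<Sum>c\<in>A. f a b c) * e a b) = plan_cost A e g1"
      unfolding plan_cost_def using sum_c by (intro sum.cong) auto
    also have "(\<Sum>a\<in>A. \<Sum>b\<in>A. \<Sum>c\<in>A. f a b c * e c b) = (\<Sum>c\<in>A. \<Sum>b\<in>A. (\<Sum>a\<in>A. f a b c) * e c b)"
    proof -
      have "(\<Sum>a\<in>A. \<Sum>b\<in>A. \<Sum>c\<in>A. f a b c * e c b) = (\<Sum>a\<in>A. \<Sum>c\<in>A. \<Sum>b\<in>A. f a b c * e c b)"
        by (intro sum.cong refl sum.swap)
      also have "\<dots> = (\<Sum>c\<in>A. \<Sum>a\<in>A. \<Sum>b\<in>A. f a b c * e c b)" by (rule sum.swap)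
      also have "\<dots> = (\<Sum>c\<in>A. \<Sum>b\<in>A. \<Sum>a\<in>A. f a b c * e c b)"
        by (intro sum.cong refl sum.swap)
      finally show ?thesis by (simp add: sum_distrib_right)
    qed
    also have "\<dots> = plan_cost A e g2"
      unfolding plan_cost_def using sum_a by (intro sum.cong) auto
    finally show ?thesis .
  qed
  ultimately show ?thesis by (rule that)
qed

definition cell_mass :: "'a set \<Rightarrow> ('a \<Rightarrow> 'b) \<Rightarrow> ('a \<Rightarrow> real) \<Rightarrow> 'b \<Rightarrow> real" where
  "cell_mass A \<tau> f c = (\<Sum>a\<in>{a\<in>A. \<tau> a = c}. f a)"

lemma sum_cell_mass:
  assumes "finite A"
  shows "(\<Sum>c\<in>\<tau> ` A. cell_mass A \<tau> f c) = sum f A"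
  unfolding cell_mass_def by (rule sum.group) (use assms in auto)

lemma cell_mass_diff:
  "cell_mass A \<tau> (\<lambda>a. f a - g a) c = cell_mass A \<tau> f c - cell_mass A \<tau> g c"
  by (simp add: cell_mass_def sum_subtractf)

lemma cell_mass_nonneg:
  "(\<And>a. a \<in> A \<Longrightarrow> 0 \<le> f a) \<Longrightarrow> 0 \<le> cell_mass A \<tau> f c"
  unfolding cell_mass_def by (rule sum_nonneg) auto

text \<open>
  Transport within the cells of a partition does not move mass between cells.
\<close>

lemma cell_mass_marginals_eq:
  assumes "finite A" and supp: "\<And>a b. a \<in> A \<Longrightarrow> b \<in> A \<Longrightarrow> g a b \<noteq> 0 \<Longrightarrow> \<tau> a = \<tau> b"
  shows "cell_mass A \<tau> (\<lambda>a. \<Sum>b\<in>A. g a b) c = cell_mass A \<tau> (\<lambda>b. \<Sum>a\<in>A. g a b) c"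
proof -
  have "cell_mass A \<tau> (\<lambda>a. \<Sum>b\<in>A. g a b) c = (\<Sum>a\<in>A. \<Sum>b\<in>A. if \<tau> a = c then g a b else 0)"
    unfolding cell_mass_def sum.inter_filter[OF assms(1)] by (intro sum.cong refl) auto
  also have "\<dots> = (\<Sum>a\<in>A. \<Sum>b\<in>A. if \<tau> b = c then g a b else 0)"
  proof (intro sum.cong refl)
    fix a b assume "a \<in> A" "b \<in> A"
    then show "(if \<tau> a = c then g a b else 0) = (if \<tau> b = c then g a b else 0)"
      using supp[of a b] by (cases "g a b = 0") auto
  qed
  also have "\<dots> = (\<Sum>b\<in>A. \<Sum>a\<in>A. if \<tau> b = c then g a b else 0)" by (rule sum.swap)
  also have "\<dots> = cell_mass A \<tau> (\<lambda>b. \<Sum>a\<in>A. g a b) c"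
    unfolding cell_mass_def sum.inter_filter[OF assms(1)] by (intro sum.cong refl) auto
  finally show ?thesis .
qed

text \<open>
  In a cell with masses \<open>P\<close> and \<open>Q\<close> take \<open>g a b = p a * q b / max P Q\<close>. Its row sums are
  \<open>p a * (Q / max P Q) \<le> p a\<close>, symmetrically for the columns, and its total is \<open>P * Q / max P Q = min P Q\<close>, the
  largest mass that can be matched inside the cell. A cell without mass contributes \<open>0 / 0 = 0\<close>.
\<close>

lemma match_within_cells:
  fixes p q :: "'a \<Rightarrow> real" and \<tau> :: "'a \<Rightarrow> 'b"
  assumes A: "finite A" and p: "\<forall>a\<in>A. 0 \<le> p a" and q: "\<forall>a\<in>A. 0 \<le> q a"
  shows "\<exists>g. (\<forall>a\<in>A. \<forall>b\<in>A. 0 \<le> g a b \<and> (g a b \<noteq> 0 \<longrightarrow> \<tau> a = \<tau> b)) \<and>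
    (\<forall>a\<in>A. (\<Sum>b\<in>A. g a b) \<le> p a) \<and> (\<forall>b\<in>A. (\<Sum>a\<in>A. g a b) \<le> q b) \<and>
    (\<forall>c. cell_mass A \<tau> (\<lambda>a. \<Sum>b\<in>A. g a b) c = min (cell_mass A \<tau> p c) (cell_mass A \<tau> q c))"
proof -
  let ?P = "cell_mass A \<tau> p" and ?Q = "cell_mass A \<tau> q"
  define m where "m c = max (?P c) (?Q c)" for c
  define g where "g a b = (if \<tau> a = \<tau> b then p a * q b / m (\<tau> a) else 0)" for a b
  have PQ: "0 \<le> ?P c" "0 \<le> ?Q c" "0 \<le> m c" "?P c \<le> m c" "?Q c \<le> m c" for c
    using cell_mass_nonneg[of A p] cell_mass_nonneg[of A q] p q by (auto simp: m_def max_def)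
  have row: "(\<Sum>b\<in>A. g a b) = p a * (?Q (\<tau> a) / m (\<tau> a))" for a
  proof -
    have "(\<Sum>b\<in>A. g a b) = (\<Sum>b\<in>{b\<in>A. \<tau> b = \<tau> a}. p a * q b / m (\<tau> a))"
      using A by (simp add: sum.inter_filter g_def eq_commute)
    then show ?thesis by (simp add: cell_mass_def sum_distrib_left sum_divide_distrib)
  qed
  have col: "(\<Sum>a\<in>A. g a b) = q b * (?P (\<tau> b) / m (\<tau> b))" for b
  proof -
    have "(\<Sum>a\<in>A. g a b) = (\<Sum>a\<in>{a\<in>A. \<tau> a = \<tau> b}. p a * q b / m (\<tau> b))"
      using A by (simp add: sum.inter_filter g_def) (intro sum.cong, auto)
    then show ?thesis by (simp add: cell_mass_def sum_distrib_left sum_divide_distrib mult.commute)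
  qed
  have frac: "x / m c \<le> 1" if "x \<le> m c" for x c
    using that PQ(3)[of c] by (cases "m c = 0") (auto simp: field_simps)
  show ?thesis
  proof (intro exI[of _ g] conjI ballI allI impI)
    fix a b assume ab: "a \<in> A" "b \<in> A"
    show "0 \<le> g a b"
      using ab p q PQ(3) by (simp add: g_def)
    show "\<tau> a = \<tau> b" if "g a b \<noteq> 0" using that by (auto simp: g_def split: if_splits)
  next
    fix a assume a: "a \<in> A"
    show "(\<Sum>b\<in>A. g a b) \<le> p a"
      unfolding row using bspec[OF p a] frac[OF PQ(5)] by (intro mult_left_le)
    show "(\<Sum>b\<in>A. g b a) \<le> q a"
      unfolding col using bspec[OF q a] frac[OF PQ(4)] by (intro mult_left_le)
  next
    fix c
    have "cell_mass A \<tau> (\<lambda>a. \<Sum>b\<in>A. g a b) c = ?P c * (?Q c / m c)"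
      unfolding row cell_mass_def sum_distrib_right by (intro sum.cong) auto
    also have "\<dots> = min (?P c) (?Q c)"
      using PQ[of c] by (auto simp: m_def min_def max_def)
    finally show "cell_mass A \<tau> (\<lambda>a. \<Sum>b\<in>A. g a b) c = min (?P c) (?Q c)" .
  qed
qed

text \<open>
  Mass is matched within the finest cells first and the rest is passed to the next coarser partition. Each
  round of matching takes equal masses from both sides of every cell, so the differences of cell masses
  on the coarser levels stay the same. After level \<open>l + 1\<close> the unmatched mass is half the sum of
  these differences, and it travels at most \<open>\<delta> l\<close> if it is matched on level \<open>l\<close>. At the root everything
  that is left can be matched.
\<close>

lemma multiscale_plan:
  fixes p q :: "'a \<Rightarrow> real" and \<tau> :: "nat \<Rightarrow> 'a \<Rightarrow> 'b" and \<delta> :: "nat \<Rightarrow> real"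
  assumes A: "finite A" and p: "\<And>a. a \<in> A \<Longrightarrow> 0 \<le> p a" and q: "\<And>a. a \<in> A \<Longrightarrow> 0 \<le> q a"
    and total: "sum p A = sum q A"
    and refine: "\<And>l m a b. l \<le> m \<Longrightarrow> m \<le> L \<Longrightarrow> a \<in> A \<Longrightarrow> b \<in> A \<Longrightarrow> \<tau> m a = \<tau> m b \<Longrightarrow> \<tau> l a = \<tau> l b"
    and root: "\<And>a b. a \<in> A \<Longrightarrow> b \<in> A \<Longrightarrow> \<tau> 0 a = \<tau> 0 b"
    and cost: "\<And>l a b. l \<le> L \<Longrightarrow> a \<in> A \<Longrightarrow> b \<in> A \<Longrightarrow> \<tau> l a = \<tau> l b \<Longrightarrow> cost a b \<le> \<delta> l"
    and \<delta>: "\<And>l. 0 \<le> \<delta> l"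
  shows "\<exists>g. finite_plan A p q g \<and> plan_cost A cost g
        \<le> \<delta> L * sum p A + (\<Sum>l<L. \<delta> l *
            ((\<Sum>c\<in>\<tau> (Suc l) ` A. \<bar>cell_mass A (\<tau> (Suc l)) p c - cell_mass A (\<tau> (Suc l)) q c\<bar>) / 2))"
  using p q total refine cost
proof (induction L arbitrary: p q)
  case 0
  have pq: "\<forall>a\<in>A. 0 \<le> p a" "\<forall>a\<in>A. 0 \<le> q a" using 0(1,2) by auto
  obtain g where "\<forall>a\<in>A. \<forall>b\<in>A. 0 \<le> g a b \<and> (g a b \<noteq> 0 \<longrightarrow> \<tau> 0 a = \<tau> 0 b)"
    "\<forall>a\<in>A. (\<Sum>b\<in>A. g a b) \<le> p a" "\<forall>b\<in>A. (\<Sum>a\<in>A. g a b) \<le> q b"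
    "\<forall>c. cell_mass A (\<tau> 0) (\<lambda>a. \<Sum>b\<in>A. g a b) c = min (cell_mass A (\<tau> 0) p c) (cell_mass A (\<tau> 0) q c)"
    using match_within_cells[OF A pq, where \<tau> = "\<tau> 0"] by (elim exE conjE)
  then have g: "\<And>a b. a \<in> A \<Longrightarrow> b \<in> A \<Longrightarrow> 0 \<le> g a b"
    "\<And>a. a \<in> A \<Longrightarrow> (\<Sum>b\<in>A. g a b) \<le> p a" "\<And>b. b \<in> A \<Longrightarrow> (\<Sum>a\<in>A. g a b) \<le> q b"
    "\<And>c. cell_mass A (\<tau> 0) (\<lambda>a. \<Sum>b\<in>A. g a b) c = min (cell_mass A (\<tau> 0) p c) (cell_mass A (\<tau> 0) q c)"
    by simp_all
  have single: "cell_mass A (\<tau> 0) f (\<tau> 0 a) = sum f A" if "a \<in> A" for f a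
  proof -
    have "{x\<in>A. \<tau> 0 x = \<tau> 0 a} = A" using root that by blast
    then show ?thesis by (simp add: cell_mass_def)
  qed
  have row_total: "(\<Sum>a\<in>A. \<Sum>b\<in>A. g a b) = sum p A"
  proof (cases "A = {}")
    case False
    then obtain a where "a \<in> A" by auto
    with g(4)[of "\<tau> 0 a"] 0(3) show ?thesis by (simp add: single)
  qed simp
  \<comment> \<open>The root is a single cell and the totals agree, so its matching exhausts both sides.\<close>
  have tight: "u a = v a" if "\<And>a. a \<in> A \<Longrightarrow> u a \<le> v a" "sum u A = sum v A" "a \<in> A" for u v :: "'a \<Rightarrow> real" and a
  proof (rule ccontr)
    assume "u a \<noteq> v a"
    with that(1)[OF that(3)] have "u a < v a" by simp
    with that A have "sum u A < sum v A" by (intro sum_strict_mono_ex1) auto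
    with that(2) show False by simp
  qed
  have "(\<Sum>b\<in>A. g a b) = p a" if "a \<in> A" for a using tight[of "\<lambda>a. \<Sum>b\<in>A. g a b" p a] g(2) row_total that by simp
  moreover have "(\<Sum>a\<in>A. g a b) = q b" if "b \<in> A" for b
    using tight[of "\<lambda>b. \<Sum>a\<in>A. g a b" q b] g(3) row_total 0(3) that sum.swap[of g A A] by simp
  moreover have "(\<Sum>a\<in>A. \<Sum>b\<in>A. g a b * cost a b) \<le> \<delta> 0 * sum p A"
  proof -
    have "(\<Sum>a\<in>A. \<Sum>b\<in>A. g a b * cost a b) \<le> (\<Sum>a\<in>A. \<Sum>b\<in>A. g a b * \<delta> 0)"
      by (intro sum_mono mult_left_mono 0(5) root g(1)) auto
    then show ?thesis by (simp only: sum_distrib_right[symmetric] row_total mult.commute[of "\<delta> 0"])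
  qed
  ultimately show ?case using g(1)
    by (intro exI[of _ g]) (auto simp: finite_plan_def plan_cost_def)
next
  case (Suc L)
  let ?\<tau> = "\<tau> (Suc L)"
  have pq: "\<forall>a\<in>A. 0 \<le> p a" "\<forall>a\<in>A. 0 \<le> q a" using Suc.prems(1,2) by auto
  obtain g where "\<forall>a\<in>A. \<forall>b\<in>A. 0 \<le> g a b \<and> (g a b \<noteq> 0 \<longrightarrow> ?\<tau> a = ?\<tau> b)"
    "\<forall>a\<in>A. (\<Sum>b\<in>A. g a b) \<le> p a" "\<forall>b\<in>A. (\<Sum>a\<in>A. g a b) \<le> q b"
    "\<forall>c. cell_mass A ?\<tau> (\<lambda>a. \<Sum>b\<in>A. g a b) c = min (cell_mass A ?\<tau> p c) (cell_mass A ?\<tau> q c)"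
    using match_within_cells[OF A pq, where \<tau> = "?\<tau>"] by (elim exE conjE)
  then have g: "\<And>a b. a \<in> A \<Longrightarrow> b \<in> A \<Longrightarrow> 0 \<le> g a b"
    "\<And>a b. a \<in> A \<Longrightarrow> b \<in> A \<Longrightarrow> g a b \<noteq> 0 \<Longrightarrow> ?\<tau> a = ?\<tau> b"
    "\<And>a. a \<in> A \<Longrightarrow> (\<Sum>b\<in>A. g a b) \<le> p a" "\<And>b. b \<in> A \<Longrightarrow> (\<Sum>a\<in>A. g a b) \<le> q b"
    "\<And>c. cell_mass A ?\<tau> (\<lambda>a. \<Sum>b\<in>A. g a b) c = min (cell_mass A ?\<tau> p c) (cell_mass A ?\<tau> q c)"
    by simp_all
  define row where "row = (\<lambda>a. \<Sum>b\<in>A. g a b)"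
  define col where "col = (\<lambda>b. \<Sum>a\<in>A. g a b)"
  define p' where "p' = (\<lambda>a. p a - row a)"
  define q' where "q' = (\<lambda>b. q b - col b)"
  have swap: "sum row A = sum col A" unfolding row_def col_def by (rule sum.swap)
  have marg: "cell_mass A (\<tau> l) row c = cell_mass A (\<tau> l) col c" if "l \<le> Suc L" for l c
    unfolding row_def col_def
  proof (rule cell_mass_marginals_eq[OF A])
    fix a b assume ab: "a \<in> A" "b \<in> A" "g a b \<noteq> 0"
    show "\<tau> l a = \<tau> l b" by (rule Suc.prems(4)[OF that order_refl ab(1,2) g(2)[OF ab]])
  qed
  then have diff: "cell_mass A (\<tau> l) p' c - cell_mass A (\<tau> l) q' c = cell_mass A (\<tau> l) p c - cell_mass A (\<tau> l) q c"
    if "l \<le> Suc L" for l c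
    using that by (simp add: p'_def q'_def cell_mass_diff)
  have "\<exists>g'. finite_plan A p' q' g' \<and> plan_cost A cost g'
        \<le> \<delta> L * sum p' A + (\<Sum>l<L. \<delta> l *
            ((\<Sum>c\<in>\<tau> (Suc l) ` A. \<bar>cell_mass A (\<tau> (Suc l)) p' c - cell_mass A (\<tau> (Suc l)) q' c\<bar>) / 2))"
  proof (rule Suc.IH)
    show "0 \<le> p' a" "0 \<le> q' a" if "a \<in> A" for a
      using g(3,4) that by (auto simp: p'_def q'_def row_def col_def)
    show "sum p' A = sum q' A"
      using swap Suc.prems(3) by (simp add: p'_def q'_def sum_subtractf)
    show "\<tau> l a = \<tau> l b" if "l \<le> m" "m \<le> L" "a \<in> A" "b \<in> A" "\<tau> m a = \<tau> m b" for l m a b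
      using Suc.prems(4)[of l m a b] that by auto
    show "cost a b \<le> \<delta> l" if "l \<le> L" "a \<in> A" "b \<in> A" "\<tau> l a = \<tau> l b" for l a b
      using Suc.prems(5)[of l a b] that by auto
  qed
  then obtain g' where g': "finite_plan A p' q' g'" "plan_cost A cost g'
        \<le> \<delta> L * sum p' A + (\<Sum>l<L. \<delta> l *
            ((\<Sum>c\<in>\<tau> (Suc l) ` A. \<bar>cell_mass A (\<tau> (Suc l)) p' c - cell_mass A (\<tau> (Suc l)) q' c\<bar>) / 2))"
    by (elim exE conjE)
  have g'_cost: "plan_cost A cost g'
        \<le> \<delta> L * sum p' A + (\<Sum>l<L. \<delta> l *
            ((\<Sum>c\<in>\<tau> (Suc l) ` A. \<bar>cell_mass A (\<tau> (Suc l)) p c - cell_mass A (\<tau> (Suc l)) q c\<bar>) / 2))"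
    using g'(2) by (simp add: diff)
  \<comment> \<open>What is left of \<open>p\<close> in a cell is the positive part of the difference of its masses.\<close>
  have half: "sum p' A = (\<Sum>c\<in>?\<tau> ` A. \<bar>cell_mass A ?\<tau> p c - cell_mass A ?\<tau> q c\<bar>) / 2"
  proof -
    have "sum p' A = (\<Sum>c\<in>?\<tau> ` A. cell_mass A ?\<tau> p' c)" using sum_cell_mass[OF A] by metis
    also have "\<dots> = (\<Sum>c\<in>?\<tau> ` A. (\<bar>cell_mass A ?\<tau> p c - cell_mass A ?\<tau> q c\<bar>
        + (cell_mass A ?\<tau> p c - cell_mass A ?\<tau> q c)) / 2)"
      using g(5) by (intro sum.cong) (auto simp: p'_def cell_mass_diff row_def min_def)
    also have "\<dots> = (\<Sum>c\<in>?\<tau> ` A. \<bar>cell_mass A ?\<tau> p c - cell_mass A ?\<tau> q c\<bar>) / 2"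
      using Suc.prems(3)
      by (simp add: sum_divide_distrib[symmetric] sum.distrib sum_subtractf sum_cell_mass[OF A])
    finally show ?thesis .
  qed
  have "plan_cost A cost g \<le> (\<Sum>a\<in>A. \<Sum>b\<in>A. g a b * \<delta> (Suc L))"
    unfolding plan_cost_def
  proof (intro sum_mono)
    fix a b assume ab: "a \<in> A" "b \<in> A"
    show "g a b * cost a b \<le> g a b * \<delta> (Suc L)"
    proof (cases "g a b = 0")
      case False
      show ?thesis
        by (rule mult_left_mono[OF Suc.prems(5)[OF order_refl ab g(2)[OF ab False]] g(1)[OF ab]])
    qed simp
  qed
  also have "\<dots> = \<delta> (Suc L) * sum row A"
    by (simp only: row_def sum_distrib_right[symmetric] mult.commute[of "\<delta> (Suc L)"])
  also have "\<dots> \<le> \<delta> (Suc L) * sum p A"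
    using g(3) \<delta> by (intro mult_left_mono sum_mono) (auto simp: row_def)
  finally have "plan_cost A cost (\<lambda>a b. g a b + g' a b)
      \<le> \<delta> (Suc L) * sum p A + (\<Sum>l<Suc L. \<delta> l *
            ((\<Sum>c\<in>\<tau> (Suc l) ` A. \<bar>cell_mass A (\<tau> (Suc l)) p c - cell_mass A (\<tau> (Suc l)) q c\<bar>) / 2))"
    using g'_cost half by (simp add: plan_cost_def distrib_right sum.distrib)
  moreover have "finite_plan A p q (\<lambda>a b. g a b + g' a b)"
    using g'(1) g(1) by (simp add: finite_plan_def sum.distrib p'_def q'_def row_def col_def)
  ultimately show ?case by (intro exI conjI)
qed

section \<open>From couplings to finite plans and back\<close>

lemma nn_integral_finite_values:
  assumes A: "finite A" and T [measurable]: "T \<in> measurable M (count_space A)"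
  shows "(\<integral>\<^sup>+x. F (T x) \<partial>M) = (\<Sum>a\<in>A. F a * emeasure M (T -` {a} \<inter> space M))"
proof -
  have "(\<integral>\<^sup>+x. F (T x) \<partial>M) = (\<integral>\<^sup>+x. (\<Sum>a\<in>A. F a * indicator (T -` {a} \<inter> space M) x) \<partial>M)"
  proof (rule nn_integral_cong)
    fix x assume x: "x \<in> space M"
    then have "T x \<in> A" using measurable_space[OF T] by auto
    then show "F (T x) = (\<Sum>a\<in>A. F a * indicator (T -` {a} \<inter> space M) x)"
      using x A by (subst sum.remove[of _ "T x"]) (auto simp: indicator_def intro!: sum.neutral)
  qed
  also have "\<dots> = (\<Sum>a\<in>A. F a * emeasure M (T -` {a} \<inter> space M))"
  proof (subst nn_integral_sum)
    have [measurable]: "T -` {a} \<inter> space M \<in> sets M" if "a \<in> A" for a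
      using that by measurable auto
    show "(\<lambda>x. F a * indicator (T -` {a} \<inter> space M) x) \<in> borel_measurable M" if "a \<in> A" for a
      using that by measurable
    show "(\<Sum>a\<in>A. \<integral>\<^sup>+x. F a * indicator (T -` {a} \<inter> space M) x \<partial>M) = (\<Sum>a\<in>A. F a * emeasure M (T -` {a} \<inter> space M))"
      by (intro sum.cong refl nn_integral_cmult_indicator) measurable
  qed
  finally show ?thesis .
qed

lemma sum_measure_fibres:
  assumes "prob_space M" and A: "finite A" and T [measurable]: "T \<in> measurable M (count_space A)"
    and X: "X \<in> sets M"
  shows "(\<Sum>a\<in>A. measure M (T -` {a} \<inter> X)) = measure M X"
proof -
  interpret prob_space M by fact
  have fib: "T -` {a} \<inter> X \<in> sets M" if "a \<in> A" for a
  proof -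
    have "T -` {a} \<inter> X = (T -` {a} \<inter> space M) \<inter> X" using sets.sets_into_space[OF X] by auto
    moreover have "T -` {a} \<inter> space M \<in> sets M" using that by measurable auto
    ultimately show ?thesis using X by auto
  qed
  have "measure M (\<Union>a\<in>A. T -` {a} \<inter> X) = (\<Sum>a\<in>A. measure M (T -` {a} \<inter> X))"
    using A fib by (intro finite_measure_finite_Union) (auto simp: disjoint_family_on_def)
  moreover have "(\<Union>a\<in>A. T -` {a} \<inter> X) = X"
    using measurable_space[OF T] sets.sets_into_space[OF X] by auto
  ultimately show ?thesis by simp
qed

text \<open>
  The entries are the probabilities of the products of two cells. They determine the expectation
  of every cost that is constant on such products.
\<close>

lemma coupling_finite_plan:
  assumes P: "prob_space P" and Q: "prob_space Q" and \<gamma>: "\<gamma> \<in> couplings P Q" and A: "finite A"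
    and TP: "T \<in> measurable P (count_space A)" and TQ: "T \<in> measurable Q (count_space A)"
  shows "\<exists>g. finite_plan A (\<lambda>a. measure P (T -` {a} \<inter> space P)) (\<lambda>a. measure Q (T -` {a} \<inter> space Q)) g \<and>
    (\<forall>c. (\<forall>a\<in>A. \<forall>b\<in>A. 0 \<le> c a b) \<longrightarrow>
       (\<integral>\<^sup>+z. ennreal (c (T (fst z)) (T (snd z))) \<partial>\<gamma>) = ennreal (plan_cost A c g))"
proof -
  have sets: "sets \<gamma> = sets (P \<Otimes>\<^sub>M Q)" and P_eq: "distr \<gamma> P fst = P" and Q_eq: "distr \<gamma> Q snd = Q"
    using \<gamma> by (auto simp: couplings_def)
  have fst [measurable]: "fst \<in> measurable \<gamma> P" and snd [measurable]: "snd \<in> measurable \<gamma> Q"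
    by (simp_all add: measurable_cong_sets[OF sets refl])
  interpret prob_space \<gamma> using P fst by (subst (asm) P_eq[symmetric]) (rule prob_space_distrD)
  have Tf [measurable]: "(\<lambda>z. T (fst z)) \<in> measurable \<gamma> (count_space A)"
    and Ts [measurable]: "(\<lambda>z. T (snd z)) \<in> measurable \<gamma> (count_space A)"
    using measurable_compose[OF fst TP] measurable_compose[OF snd TQ] by auto
  define X where "X a = (\<lambda>z. T (fst z)) -` {a} \<inter> space \<gamma>" for a
  define Y where "Y b = (\<lambda>z. T (snd z)) -` {b} \<inter> space \<gamma>" for b
  have XY: "X a \<in> events" "Y a \<in> events" if "a \<in> A" for a
    unfolding X_def Y_def using that by (measurable, auto)
  define g where "g a b = prob (X a \<inter> Y b)" for a b
  have "(\<Sum>b\<in>A. g a b) = measure P (T -` {a} \<inter> space P)" if "a \<in> A" for a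
  proof -
    have "X a \<inter> Y b = (\<lambda>z. T (snd z)) -` {b} \<inter> X a" for b by (auto simp: X_def Y_def)
    then have "(\<Sum>b\<in>A. g a b) = prob (X a)"
      using sum_measure_fibres[OF prob_space_axioms A Ts XY(1)[OF that]] by (simp add: g_def)
    also have "\<dots> = measure (distr \<gamma> P fst) (T -` {a} \<inter> space P)"
      using that measurable_space[OF fst] measurable_sets[OF TP, of "{a}"]
      by (subst measure_distr) (auto simp: X_def intro!: arg_cong[of _ _ prob])
    finally show ?thesis by (simp add: P_eq)
  qed
  moreover have "(\<Sum>a\<in>A. g a b) = measure Q (T -` {b} \<inter> space Q)" if "b \<in> A" for b
  proof -
    have "X a \<inter> Y b = (\<lambda>z. T (fst z)) -` {a} \<inter> Y b" for a by (auto simp: X_def Y_def)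
    then have "(\<Sum>a\<in>A. g a b) = prob (Y b)"
      using sum_measure_fibres[OF prob_space_axioms A Tf XY(2)[OF that]] by (simp add: g_def)
    also have "\<dots> = measure (distr \<gamma> Q snd) (T -` {b} \<inter> space Q)"
      using that measurable_space[OF snd] measurable_sets[OF TQ, of "{b}"]
      by (subst measure_distr) (auto simp: Y_def intro!: arg_cong[of _ _ prob])
    finally show ?thesis by (simp add: Q_eq)
  qed
  moreover have "(\<integral>\<^sup>+z. ennreal (c (T (fst z)) (T (snd z))) \<partial>\<gamma>) = ennreal (plan_cost A c g)"
    if c: "\<And>a b. a \<in> A \<Longrightarrow> b \<in> A \<Longrightarrow> 0 \<le> c a b" for c
  proof -
    have T2: "(\<lambda>z. (T (fst z), T (snd z))) \<in> measurable \<gamma> (count_space (A \<times> A))"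
      using measurable_Pair[OF Tf Ts] by (simp add: pair_measure_countable A countable_finite)
    have "(\<integral>\<^sup>+z. ennreal (c (T (fst z)) (T (snd z))) \<partial>\<gamma>)
        = (\<Sum>x\<in>A \<times> A. ennreal (case_prod c x) * emeasure \<gamma> ((\<lambda>z. (T (fst z), T (snd z))) -` {x} \<inter> space \<gamma>))"
      using nn_integral_finite_values[OF _ T2, of "\<lambda>x. ennreal (case_prod c x)"] A by simp
    also have "\<dots> = (\<Sum>x\<in>A \<times> A. ennreal (case_prod (\<lambda>a b. g a b * c a b) x))"
    proof (intro sum.cong refl, clarify)
      fix a b assume ab: "a \<in> A" "b \<in> A"
      have "(\<lambda>z. (T (fst z), T (snd z))) -` {(a, b)} \<inter> space \<gamma> = X a \<inter> Y b"
        by (auto simp: X_def Y_def)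
      then show "ennreal (c a b) * emeasure \<gamma> ((\<lambda>z. (T (fst z), T (snd z))) -` {(a, b)} \<inter> space \<gamma>)
          = ennreal (g a b * c a b)"
        using c[OF ab] by (simp add: g_def emeasure_eq_measure ennreal_mult mult.commute)
    qed
    also have "\<dots> = ennreal (plan_cost A c g)"
      using c by (subst sum_ennreal) (auto simp: g_def plan_cost_def sum.cartesian_product)
    finally show ?thesis .
  qed
  ultimately show ?thesis
    by (intro exI[of _ g]) (auto simp: finite_plan_def g_def)
qed

text \<open>
  The plan becomes a coupling by spreading the mass \<open>g a b\<close> over the product of the cells \<open>a\<close> and \<open>b\<close>
  like \<open>P \<Otimes>\<^sub>M R\<close>, i.e. through the density \<open>g a b / (P(a) * R(b))\<close>. The marginals hold because the row and column
  sums of \<open>g\<close> are the cell masses. Cells of mass zero form a null set, and their rows and columns vanish.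
\<close>

lemma wdist_le_plan_cost:
  assumes P: "prob_space P" and R: "prob_space R" and A: "finite A"
    and TP [measurable]: "T \<in> measurable P (count_space A)"
    and TR [measurable]: "T \<in> measurable R (count_space A)"
    and g: "finite_plan A (\<lambda>a. measure P (T -` {a} \<inter> space P)) (\<lambda>a. measure R (T -` {a} \<inter> space R)) g"
    and c: "\<And>a b. a \<in> A \<Longrightarrow> b \<in> A \<Longrightarrow> 0 \<le> c a b"
    and cost: "\<And>s t. s \<in> space P \<Longrightarrow> t \<in> space R \<Longrightarrow> pnorm p (s - t) \<le> c (T s) (T t)"
  shows "wdist p P R \<le> ennreal (plan_cost A c g)"
proof -
  interpret P: prob_space P by fact
  interpret R: prob_space R by fact
  interpret PR: pair_sigma_finite P R ..
  define u where "u a = measure P (T -` {a} \<inter> space P)" for a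
  define v where "v b = measure R (T -` {b} \<inter> space R)" for b
  note le = finite_plan_le[OF A g, folded u_def v_def]
  have uv: "0 \<le> u a" "0 \<le> v a" for a by (auto simp: u_def v_def)
  have em: "emeasure P (T -` {a} \<inter> space P) = ennreal (u a)" "emeasure R (T -` {a} \<inter> space R) = ennreal (v a)" for a
    by (auto simp: u_def v_def P.emeasure_eq_measure R.emeasure_eq_measure)
  have TA: "T s \<in> A" if "s \<in> space P \<or> s \<in> space R" for s
    using that measurable_space[OF TP] measurable_space[OF TR] by auto
  have meas: "(\<lambda>z. F (T (fst z)) (T (snd z))) \<in> borel_measurable (P \<Otimes>\<^sub>M R)" for F :: "'b \<Rightarrow> 'b \<Rightarrow> ennreal"
  proof -
    have T1: "(\<lambda>z. T (fst z)) \<in> measurable (P \<Otimes>\<^sub>M R) (count_space A)"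
      and T2: "(\<lambda>z. T (snd z)) \<in> measurable (P \<Otimes>\<^sub>M R) (count_space A)" by measurable
    have "(\<lambda>z. (T (fst z), T (snd z))) \<in> measurable (P \<Otimes>\<^sub>M R) (count_space (A \<times> A))"
      using measurable_Pair[OF T1 T2] by (simp add: pair_measure_countable A countable_finite)
    from measurable_compose[OF this, of "case_prod F" borel] show ?thesis by simp
  qed
  define f where "f a b = ennreal (g a b / (u a * v b))" for a b
  have f_meas [measurable]: "(\<lambda>z. f (T (fst z)) (T (snd z))) \<in> borel_measurable (P \<Otimes>\<^sub>M R)" by (rule meas)
  define \<gamma> where "\<gamma> = density (P \<Otimes>\<^sub>M R) (\<lambda>z. f (T (fst z)) (T (snd z)))"
  have int_v: "f a b * ennreal (v b) = ennreal (g a b / u a)"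
    and int_u: "f a b * ennreal (u a) = ennreal (g a b / v b)" if "a \<in> A" "b \<in> A" for a b
    using le[OF that] uv by (auto simp: f_def ennreal_mult[symmetric])
  have fR: "(\<integral>\<^sup>+t. f (T s) (T t) \<partial>R) = 1" if "s \<in> space P" "u (T s) \<noteq> 0" for s
  proof -
    have "(\<integral>\<^sup>+t. f (T s) (T t) \<partial>R) = (\<Sum>b\<in>A. ennreal (g (T s) b / u (T s)))"
      using TA that by (subst nn_integral_finite_values[OF A TR]) (auto simp: em int_v intro!: sum.cong)
    also have "\<dots> = ennreal ((\<Sum>b\<in>A. g (T s) b) / u (T s))"
      using TA that le uv by (subst sum_ennreal) (auto simp: sum_divide_distrib)
    also have "\<dots> = 1" using that TA g by (simp add: finite_plan_def u_def)
    finally show ?thesis .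
  qed
  have fP: "(\<integral>\<^sup>+s. f (T s) (T t) \<partial>P) = 1" if "t \<in> space R" "v (T t) \<noteq> 0" for t
  proof -
    have "(\<integral>\<^sup>+s. f (T s) (T t) \<partial>P) = (\<Sum>a\<in>A. ennreal (g a (T t) / v (T t)))"
      using TA that by (subst nn_integral_finite_values[OF A TP]) (auto simp: em int_u intro!: sum.cong)
    also have "\<dots> = ennreal ((\<Sum>a\<in>A. g a (T t)) / v (T t))"
      using TA that le uv by (subst sum_ennreal) (auto simp: sum_divide_distrib)
    also have "\<dots> = 1" using that TA g by (simp add: finite_plan_def v_def)
    finally show ?thesis .
  qed
  have AE_u: "AE s in P. u (T s) \<noteq> 0"
  proof -
    have "AE s in P. s \<notin> T -` {a} \<inter> space P" if "a \<in> A" "u a = 0" for a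
      using that measurable_sets[OF TP, of "{a}"] em(1)[of a] by (intro AE_not_in) (auto simp: null_sets_def)
    then have "AE s in P. \<forall>a\<in>{a\<in>A. u a = 0}. s \<notin> T -` {a} \<inter> space P"
      using A by (intro AE_finite_allI) auto
    then show ?thesis using AE_space by eventually_elim (use TA in \<open>auto\<close>)
  qed
  have AE_v: "AE t in R. v (T t) \<noteq> 0"
  proof -
    have "AE s in R. s \<notin> T -` {a} \<inter> space R" if "a \<in> A" "v a = 0" for a
      using that measurable_sets[OF TR, of "{a}"] em(2)[of a] by (intro AE_not_in) (auto simp: null_sets_def)
    then have "AE s in R. \<forall>a\<in>{a\<in>A. v a = 0}. s \<notin> T -` {a} \<inter> space R"
      using A by (intro AE_finite_allI) auto
    then show ?thesis using AE_space by eventually_elim (use TA in \<open>auto\<close>)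
  qed
  have "distr \<gamma> P fst = P"
  proof (rule measure_eqI)
    fix X assume "X \<in> sets (distr \<gamma> P fst)"
    then have X [measurable]: "X \<in> sets P" by simp
    have "emeasure (distr \<gamma> P fst) X = emeasure \<gamma> (X \<times> space R)"
      using sets.sets_into_space[OF X]
      by (subst emeasure_distr) (auto simp: \<gamma>_def space_pair_measure intro!: arg_cong2[of _ _ _ _ emeasure])
    also have "\<dots> = (\<integral>\<^sup>+z. f (T (fst z)) (T (snd z)) * indicator (X \<times> space R) z \<partial>(P \<Otimes>\<^sub>M R))"
      unfolding \<gamma>_def by (subst emeasure_density) auto
    also have "\<dots> = (\<integral>\<^sup>+s. \<integral>\<^sup>+t. f (T s) (T t) * indicator (X \<times> space R) (s, t) \<partial>R \<partial>P)"
      by (subst R.nn_integral_fst[symmetric]) auto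
    also have "\<dots> = (\<integral>\<^sup>+s. indicator X s \<partial>P)"
    proof (rule nn_integral_cong_AE, use AE_u AE_space in eventually_elim)
      fix s assume s: "s \<in> space P" "u (T s) \<noteq> 0"
      have "(\<integral>\<^sup>+t. f (T s) (T t) * indicator (X \<times> space R) (s, t) \<partial>R) = (\<integral>\<^sup>+t. indicator X s * f (T s) (T t) \<partial>R)"
        by (intro nn_integral_cong) (auto simp: indicator_def)
      also have "\<dots> = indicator X s * (\<integral>\<^sup>+t. f (T s) (T t) \<partial>R)"
        using measurable_compose[OF TR, of "f (T s)" borel] by (intro nn_integral_cmult) simp
      finally show "(\<integral>\<^sup>+t. f (T s) (T t) * indicator (X \<times> space R) (s, t) \<partial>R) = indicator X s"
        using fR[OF s] by simp
    qed
    finally show "emeasure (distr \<gamma> P fst) X = emeasure P X" by simp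
  qed simp
  moreover have "distr \<gamma> R snd = R"
  proof (rule measure_eqI)
    fix X assume "X \<in> sets (distr \<gamma> R snd)"
    then have X [measurable]: "X \<in> sets R" by simp
    have "emeasure (distr \<gamma> R snd) X = emeasure \<gamma> (space P \<times> X)"
      using sets.sets_into_space[OF X]
      by (subst emeasure_distr) (auto simp: \<gamma>_def space_pair_measure intro!: arg_cong2[of _ _ _ _ emeasure])
    also have "\<dots> = (\<integral>\<^sup>+z. f (T (fst z)) (T (snd z)) * indicator (space P \<times> X) z \<partial>(P \<Otimes>\<^sub>M R))"
      unfolding \<gamma>_def by (subst emeasure_density) auto
    also have "\<dots> = (\<integral>\<^sup>+t. \<integral>\<^sup>+s. f (T s) (T t) * indicator (space P \<times> X) (s, t) \<partial>P \<partial>R)"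
      by (subst PR.nn_integral_snd[symmetric]) auto
    also have "\<dots> = (\<integral>\<^sup>+t. indicator X t \<partial>R)"
    proof (rule nn_integral_cong_AE, use AE_v AE_space in eventually_elim)
      fix t assume t: "t \<in> space R" "v (T t) \<noteq> 0"
      have "(\<integral>\<^sup>+s. f (T s) (T t) * indicator (space P \<times> X) (s, t) \<partial>P) = (\<integral>\<^sup>+s. indicator X t * f (T s) (T t) \<partial>P)"
        by (intro nn_integral_cong) (auto simp: indicator_def)
      also have "\<dots> = indicator X t * (\<integral>\<^sup>+s. f (T s) (T t) \<partial>P)"
        using measurable_compose[OF TP, of "\<lambda>a. f a (T t)" borel] by (intro nn_integral_cmult) simp
      finally show "(\<integral>\<^sup>+s. f (T s) (T t) * indicator (space P \<times> X) (s, t) \<partial>P) = indicator X t"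
        using fP[OF t] by simp
    qed
    finally show "emeasure (distr \<gamma> R snd) X = emeasure R X" by simp
  qed simp
  ultimately have \<gamma>: "\<gamma> \<in> couplings P R" by (simp add: couplings_def \<gamma>_def)
  obtain g' where g': "finite_plan A (\<lambda>a. measure P (T -` {a} \<inter> space P)) (\<lambda>a. measure R (T -` {a} \<inter> space R)) g'"
    "(\<integral>\<^sup>+z. ennreal (c (T (fst z)) (T (snd z))) \<partial>\<gamma>) = ennreal (plan_cost A c g')"
    using coupling_finite_plan[OF P R \<gamma> A TP TR] c by blast
  have "wdist p P R \<le> (\<integral>\<^sup>+z. ennreal (pnorm p (fst z - snd z)) \<partial>\<gamma>)"
    unfolding wdist_def using \<gamma> by (rule INF_lower)
  also have "\<dots> \<le> (\<integral>\<^sup>+z. ennreal (c (T (fst z)) (T (snd z))) \<partial>\<gamma>)"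
    using cost by (intro nn_integral_mono ennreal_leI) (auto simp: \<gamma>_def space_pair_measure)
  also have "\<dots> = (\<integral>\<^sup>+z. f (T (fst z)) (T (snd z)) * ennreal (c (T (fst z)) (T (snd z))) \<partial>(P \<Otimes>\<^sub>M R))"
    unfolding \<gamma>_def by (rule nn_integral_density[OF f_meas meas])
  also have "\<dots> = (\<integral>\<^sup>+s. \<integral>\<^sup>+t. f (T s) (T t) * ennreal (c (T s) (T t)) \<partial>R \<partial>P)"
    using meas[of "\<lambda>a b. f a b * ennreal (c a b)"] by (subst R.nn_integral_fst[symmetric]) auto
  also have "\<dots> = (\<integral>\<^sup>+s. (\<Sum>b\<in>A. f (T s) b * ennreal (c (T s) b) * ennreal (v b)) \<partial>P)"
  proof (intro nn_integral_cong)
    fix s show "(\<integral>\<^sup>+t. f (T s) (T t) * ennreal (c (T s) (T t)) \<partial>R)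
        = (\<Sum>b\<in>A. f (T s) b * ennreal (c (T s) b) * ennreal (v b))"
      by (subst nn_integral_finite_values[OF A TR]) (simp add: em)
  qed
  also have "\<dots> = (\<Sum>a\<in>A. (\<Sum>b\<in>A. f a b * ennreal (c a b) * ennreal (v b)) * ennreal (u a))"
    by (subst nn_integral_finite_values[OF A TP]) (simp add: em)
  also have "\<dots> = (\<Sum>a\<in>A. \<Sum>b\<in>A. ennreal (g a b * c a b))"
    unfolding sum_distrib_right
  proof (intro sum.cong refl)
    fix a b assume ab: "a \<in> A" "b \<in> A"
    have "f a b * ennreal (c a b) * ennreal (v b) * ennreal (u a) = f a b * ennreal (v b) * ennreal (u a * c a b)"
      using uv c[OF ab] by (simp add: ennreal_mult mult_ac)
    also have "\<dots> = ennreal (g a b / u a * (u a * c a b))"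
      using uv c[OF ab] le[OF ab] unfolding int_v[OF ab] by (intro ennreal_mult[symmetric]) auto
    also have "g a b / u a * (u a * c a b) = g a b * c a b" using le[OF ab] by auto
    finally show "f a b * ennreal (c a b) * ennreal (v b) * ennreal (u a) = ennreal (g a b * c a b)" .
  qed
  also have "\<dots> = ennreal (plan_cost A c g)"
    using c le by (simp add: plan_cost_def sum_nonneg)
  finally show ?thesis .
qed

section \<open>Dyadic grids\<close>

text \<open>
  The index of the cell that contains \<open>s\<close> if the cube with half side \<open>B\<close> around the origin is cut into
  \<open>m\<close> pieces along each axis.
\<close>

definition grid :: "real \<Rightarrow> nat \<Rightarrow> real ^ 'k \<Rightarrow> 'k \<Rightarrow> int" where
  "grid B m s = (\<lambda>i. \<lfloor>real m * (s $ i + B) / (2 * B)\<rfloor>)"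

text \<open>
  Merging \<open>j\<close> consecutive pieces along each axis. All levels of the dyadic partition are obtained from the
  finest one in this way, so that nestedness is an identity of integer division.
\<close>

definition coarsen :: "nat \<Rightarrow> ('k \<Rightarrow> int) \<Rightarrow> 'k \<Rightarrow> int" where
  "coarsen j a = (\<lambda>i. a i div int j)"

definition labels :: "nat \<Rightarrow> ('k::finite \<Rightarrow> int) set" where
  "labels m = (UNIV \<rightarrow>\<^sub>E {0..<int m})"

lemma finite_labels [simp]: "finite (labels m)"
  by (simp add: labels_def finite_PiE)

lemma card_labels: "card (labels m :: ('k::finite \<Rightarrow> int) set) = m ^ CARD('k)"
  by (simp add: labels_def card_PiE)

lemma coarsen_labels:
  assumes "0 < j" "a \<in> labels (j * m)"
  shows "coarsen j a \<in> labels m"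
proof -
  have "0 \<le> a i div int j \<and> a i div int j < int m" for i
  proof -
    have "0 \<le> a i" "a i < int j * int m" using assms(2) by (auto simp: labels_def)
    moreover have "a i div int j < int m"
    proof (rule ccontr)
      assume "\<not> a i div int j < int m"
      then have "int j * int m \<le> int j * (a i div int j)" by (intro mult_left_mono) auto
      also have "\<dots> \<le> a i"
        using assms(1) pos_mod_sign[of "int j" "a i"] mult_div_mod_eq[of "int j" "a i"] by linarith
      finally show False using \<open>a i < int j * int m\<close> by simp
    qed
    ultimately show ?thesis using assms(1) by (simp add: pos_imp_zdiv_nonneg_iff)
  qed
  then show ?thesis by (auto simp: labels_def coarsen_def)
qed

lemma coarsen_coarsen: "coarsen j' (coarsen j a) = coarsen (j * j') a"
  by (simp add: coarsen_def fun_eq_iff zdiv_zmult2_eq)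

lemma coarsen_self: "a \<in> labels m \<Longrightarrow> coarsen m a = (\<lambda>_. 0)"
proof (rule ext)
  fix i
  assume "a \<in> labels m"
  then have "a i \<in> {0..<int m}" by (auto simp: labels_def)
  then show "coarsen m a i = 0" by (simp add: coarsen_def)
qed

lemma grid_in_labels:
  assumes "0 < m" and s: "\<And>i. \<bar>s $ i\<bar> < B"
  shows "grid B m s \<in> labels m"
proof -
  have "0 \<le> \<lfloor>real m * (s $ i + B) / (2 * B)\<rfloor> \<and> \<lfloor>real m * (s $ i + B) / (2 * B)\<rfloor> < int m" for i
  proof -
    have "0 < s $ i + B" "s $ i + B < 2 * B" "0 < B" using s[of i] by auto
    moreover then have "real m * (s $ i + B) < real m * (2 * B)"
      using assms(1) by (intro mult_strict_left_mono) auto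
    ultimately show ?thesis by (simp add: floor_less_iff divide_less_eq)
  qed
  then show ?thesis by (auto simp: labels_def grid_def)
qed

text \<open>
  Two integers with the same quotient by \<open>j\<close> differ by at most \<open>j - 1\<close>, so the reals that they round
  down differ by at most \<open>j\<close>.
\<close>

lemma coarsen_grid_close:
  fixes s t :: "real ^ 'k"
  assumes B: "0 < B" and j: "0 < j" and m: "0 < m"
    and eq: "coarsen j (grid B (j * m) s) = coarsen j (grid B (j * m) t)"
  shows "\<bar>(s - t) $ i\<bar> \<le> 2 * B / real m"
proof -
  define x where "x = real (j * m) * (s $ i + B) / (2 * B)"
  define y where "y = real (j * m) * (t $ i + B) / (2 * B)"
  have d: "\<lfloor>x\<rfloor> div int j = \<lfloor>y\<rfloor> div int j"
    using fun_cong[OF eq, of i] by (simp add: coarsen_def grid_def x_def y_def)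
  have "\<bar>\<lfloor>x\<rfloor> - \<lfloor>y\<rfloor>\<bar> = \<bar>\<lfloor>x\<rfloor> mod int j - \<lfloor>y\<rfloor> mod int j\<bar>"
    using d by (metis add_diff_cancel_left div_mult_mod_eq)
  also have "\<dots> \<le> int j - 1"
    using j pos_mod_bound[of "int j" "\<lfloor>x\<rfloor>"] pos_mod_bound[of "int j" "\<lfloor>y\<rfloor>"]
      pos_mod_sign[of "int j" "\<lfloor>x\<rfloor>"] pos_mod_sign[of "int j" "\<lfloor>y\<rfloor>"] by linarith
  finally have "\<bar>x - y\<bar> \<le> real j" by linarith
  moreover have "x - y = real j * (real m * (s - t) $ i / (2 * B))"
    by (simp add: x_def y_def diff_divide_distrib[symmetric] algebra_simps)
  ultimately have "real j * \<bar>real m * (s - t) $ i / (2 * B)\<bar> \<le> real j * 1"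
    by (simp add: abs_mult)
  then have "\<bar>real m * (s - t) $ i / (2 * B)\<bar> \<le> 1" using j by (subst (asm) mult_le_cancel_left_pos) auto
  then show ?thesis using B m by (simp add: abs_mult field_simps del: vector_minus_component)
qed

lemma measurable_grid:
  fixes \<Xi> :: "(real ^ 'k) set"
  assumes "0 < m" and \<Xi>: "\<And>s i. s \<in> \<Xi> \<Longrightarrow> \<bar>s $ i\<bar> < B"
    and M: "space M = \<Xi>" "sets M = sets (restrict_space borel \<Xi>)"
  shows "grid B m \<in> measurable M (count_space (labels m))"
proof -
  have "grid B m -` {a} \<inter> \<Xi> \<in> sets (restrict_space borel \<Xi>)" for a
  proof -
    have "grid B m -` {a} \<inter> \<Xi> = {s. \<forall>i. \<lfloor>real m * (s $ i + B) / (2 * B)\<rfloor> = a i} \<inter> \<Xi>"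
      by (auto simp: grid_def)
    moreover have "{s \<in> space borel. \<forall>i. \<lfloor>real m * (s $ i + B) / (2 * B)\<rfloor> = a i} \<in> sets borel"
      by measurable
    ultimately show ?thesis by (auto simp: sets_restrict_space)
  qed
  moreover have "grid B m s \<in> labels m" if "s \<in> \<Xi>" for s
    using grid_in_labels[OF assms(1) \<Xi>[OF that]] .
  ultimately show ?thesis
    by (subst measurable_count_space_eq2) (auto simp: M)
qed

text \<open>
  The union of the cells of level \<open>l\<close> with labels in \<open>S\<close>, for a dyadic partition with finest level \<open>L\<close>.
\<close>

definition block :: "real \<Rightarrow> nat \<Rightarrow> nat \<Rightarrow> ('k \<Rightarrow> int) set \<Rightarrow> (real ^ 'k) set" where
  "block B L l S = {s. coarsen (2 ^ (L - l)) (grid B (2 ^ L) s) \<in> S}"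

lemma block_sets:
  fixes \<Xi> :: "(real ^ 'k) set"
  assumes \<Xi>: "\<And>s i. s \<in> \<Xi> \<Longrightarrow> \<bar>s $ i\<bar> < B"
  shows "block B L l S \<inter> \<Xi> \<in> sets (restrict_space borel \<Xi>)"
proof -
  let ?M = "restrict_space borel \<Xi>"
  have T: "grid B (2 ^ L) \<in> measurable ?M (count_space (labels (2 ^ L)))"
    using \<Xi> by (intro measurable_grid[where \<Xi> = \<Xi>]) (auto simp: space_restrict_space)
  have "grid B (2 ^ L) -` {a \<in> labels (2 ^ L). coarsen (2 ^ (L - l)) a \<in> S} \<inter> space ?M \<in> sets ?M"
    using T by (rule measurable_sets) auto
  moreover have "grid B (2 ^ L) -` {a \<in> labels (2 ^ L). coarsen (2 ^ (L - l)) a \<in> S} \<inter> space ?M = block B L l S \<inter> \<Xi>"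
    using measurable_space[OF T] by (auto simp: block_def space_restrict_space)
  ultimately show ?thesis by simp
qed

section \<open>The triangle inequality for the Wasserstein distance\<close>

text \<open>
  Near-optimal couplings are discretised on a fine grid, glued along the cells of \<open>Q\<close>, and turned back into
  a coupling of \<open>P\<close> and \<open>R\<close>. Every step changes the cost by a multiple of the diameter of the cells.
  Both distances on the right are taken to \<open>Q\<close>, because the interpolation and the concentration
  bound provide distances in this direction.
\<close>

lemma wdist_triangle:
  fixes P Q R :: "(real ^ 'k) measure"
  assumes p: "1 \<le> p" and \<Xi>: "bounded \<Xi>"
    and P: "P \<in> borel_probs \<Xi>" and Q: "Q \<in> borel_probs \<Xi>" and R: "R \<in> borel_probs \<Xi>"
  shows "wdist p P R \<le> wdist p P Q + wdist p R Q"
proof (rule ennreal_le_epsilon)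
  fix \<epsilon>' :: real
  assume fin: "wdist p P Q + wdist p R Q < top" and "0 < \<epsilon>'"
  \<comment> \<open>Each of the two couplings loses \<open>4 * \<epsilon>\<close>: one for near-optimality and three for the
    discretisation.\<close>
  define \<epsilon> where "\<epsilon> = \<epsilon>' / 8"
  have \<epsilon>: "0 < \<epsilon>" using \<open>0 < \<epsilon>'\<close> by (simp add: \<epsilon>_def)
  obtain B where B: "0 < B" "\<And>s. s \<in> \<Xi> \<Longrightarrow> norm s < B"
    using \<Xi> by (metis bounded_pos_less)
  then have box: "\<bar>s $ i\<bar> < B" if "s \<in> \<Xi>" for s i
    using component_le_norm_cart[of s i] that by (meson le_less_trans)
  obtain m where m: "0 < m" "real CARD('k) * (2 * B) / \<epsilon> < real m"
  proof -
    obtain n where "real CARD('k) * (2 * B) / \<epsilon> < real n" using reals_Archimedean2 by blast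
    then show ?thesis using that[of "Suc n"] by simp
  qed
  define T where "T = (grid B m :: real ^ 'k \<Rightarrow> _)"
  define A where "A = (labels m :: ('k \<Rightarrow> int) set)"
  \<comment> \<open>\<open>\<rho>\<close> picks a representative in \<open>\<Xi>\<close> of each cell that meets \<open>\<Xi>\<close>.\<close>
  define \<rho> where "\<rho> a = (SOME s. s \<in> \<Xi> \<and> T s = a)" for a
  have A: "finite A" by (simp add: A_def)
  have \<rho>: "\<rho> (T s) \<in> \<Xi> \<and> T (\<rho> (T s)) = T s" if "s \<in> \<Xi>" for s
    unfolding \<rho>_def using that by (intro someI[of "\<lambda>u. u \<in> \<Xi> \<and> T u = T s" s]) auto
  have near: "pnorm p (s - \<rho> (T s)) \<le> \<epsilon>" if "s \<in> \<Xi>" for s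
  proof -
    have "\<bar>(s - \<rho> (T s)) $ i\<bar> \<le> 2 * B / real m" for i
      using coarsen_grid_close[OF B(1), of 1 m s "\<rho> (T s)" i] \<rho>[OF that] m(1) by (simp add: T_def)
    then have "pnorm p (s - \<rho> (T s)) \<le> real CARD('k) * (2 * B / real m)"
      by (rule pnorm_le_card[OF p])
    also have "\<dots> \<le> \<epsilon>" using m \<epsilon> by (simp add: field_simps)
    finally show ?thesis .
  qed
  have sp: "prob_space M" "space M = \<Xi>" "sets M = sets (restrict_space borel \<Xi>)" if "M \<in> borel_probs \<Xi>" for M
    using that by (auto simp: borel_probs_def)
  have T: "T \<in> measurable M (count_space A)" if "M \<in> borel_probs \<Xi>" for M
    unfolding T_def A_def using box sp[OF that] by (intro measurable_grid[OF m(1)])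
  define e where "e a b = pnorm p (\<rho> a - \<rho> b)" for a b
  have discretise: "\<exists>g. finite_plan A (\<lambda>a. measure M (T -` {a} \<inter> space M)) (\<lambda>a. measure Q (T -` {a} \<inter> space Q)) g
      \<and> ennreal (plan_cost A (\<lambda>a b. e a b + \<epsilon>) g) \<le> wdist p M Q + ennreal (4 * \<epsilon>)"
    if M: "M \<in> borel_probs \<Xi>" and less_top: "wdist p M Q < top" for M
  proof -
    have "wdist p M Q < wdist p M Q + ennreal \<epsilon>"
      using less_top \<epsilon> by (cases "wdist p M Q") (auto simp: ennreal_plus[symmetric] simp del: ennreal_plus intro!: ennreal_lessI)
    then obtain \<gamma> where \<gamma>: "\<gamma> \<in> couplings M Q"
      and le: "(\<integral>\<^sup>+ z. ennreal (pnorm p (fst z - snd z)) \<partial>\<gamma>) < wdist p M Q + ennreal \<epsilon>"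
      unfolding wdist_def[of p M Q] by (auto simp: INF_less_iff)
    obtain g where g: "finite_plan A (\<lambda>a. measure M (T -` {a} \<inter> space M)) (\<lambda>a. measure Q (T -` {a} \<inter> space Q)) g"
      and int: "\<And>c. \<forall>a\<in>A. \<forall>b\<in>A. 0 \<le> c a b \<Longrightarrow>
        (\<integral>\<^sup>+z. ennreal (c (T (fst z)) (T (snd z))) \<partial>\<gamma>) = ennreal (plan_cost A c g)"
      using coupling_finite_plan[OF sp(1)[OF M] sp(1)[OF Q] \<gamma> A T[OF M] T[OF Q]] by blast
    have sets: "sets \<gamma> = sets (M \<Otimes>\<^sub>M Q)" and M_eq: "distr \<gamma> M fst = M"
      using \<gamma> by (auto simp: couplings_def)
    have fst: "fst \<in> measurable \<gamma> M" and snd: "snd \<in> measurable \<gamma> Q"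
      by (simp_all add: measurable_cong_sets[OF sets refl])
    interpret \<gamma>: prob_space \<gamma>
      using sp(1)[OF M] fst by (subst (asm) M_eq[symmetric]) (rule prob_space_distrD)
    have incl: "(\<lambda>x. x) \<in> measurable N borel" if "N \<in> borel_probs \<Xi>" for N
      using measurable_restrict_space1[of "\<lambda>x. x" borel borel \<Xi>]
      by (simp add: measurable_cong_sets[OF sp(3)[OF that] refl])
    have [measurable]: "fst \<in> measurable \<gamma> borel" "snd \<in> measurable \<gamma> borel"
      using measurable_compose[OF fst incl[OF M]] measurable_compose[OF snd incl[OF Q]] by simp_all
    have "ennreal (plan_cost A (\<lambda>a b. e a b + \<epsilon>) g) = (\<integral>\<^sup>+z. ennreal (e (T (fst z)) (T (snd z)) + \<epsilon>) \<partial>\<gamma>)"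
      using \<epsilon> by (subst int) (auto simp: e_def pnorm_nonneg)
    also have "\<dots> \<le> (\<integral>\<^sup>+z. ennreal (pnorm p (fst z - snd z)) + ennreal (3 * \<epsilon>) \<partial>\<gamma>)"
    proof (intro nn_integral_mono)
      fix z assume z: "z \<in> space \<gamma>"
      have z': "fst z \<in> \<Xi>" "snd z \<in> \<Xi>"
        using measurable_space[OF fst z] measurable_space[OF snd z] sp(2)[OF M] sp(2)[OF Q] by auto
      let ?s = "\<rho> (T (fst z))" and ?t = "\<rho> (T (snd z))"
      have "pnorm p (?s - ?t) = pnorm p ((?s - fst z) + (fst z - snd z) + (snd z - ?t))" by simp
      also have "\<dots> \<le> pnorm p (fst z - ?s) + pnorm p (fst z - snd z) + pnorm p (snd z - ?t)"
        using pnorm_triangle[OF p, of "(?s - fst z) + (fst z - snd z)" "snd z - ?t"]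
          pnorm_triangle[OF p, of "?s - fst z" "fst z - snd z"] pnorm_commute[of p ?s "fst z"] by linarith
      also have "\<dots> \<le> pnorm p (fst z - snd z) + 2 * \<epsilon>" using near[OF z'(1)] near[OF z'(2)] by simp
      finally have "e (T (fst z)) (T (snd z)) + \<epsilon> \<le> pnorm p (fst z - snd z) + 3 * \<epsilon>" by (simp add: e_def)
      then show "ennreal (e (T (fst z)) (T (snd z)) + \<epsilon>) \<le> ennreal (pnorm p (fst z - snd z)) + ennreal (3 * \<epsilon>)"
        using \<epsilon> by (simp add: ennreal_plus[symmetric] pnorm_nonneg ennreal_leI del: ennreal_plus)
    qed
    also have "\<dots> = (\<integral>\<^sup>+z. ennreal (pnorm p (fst z - snd z)) \<partial>\<gamma>) + ennreal (3 * \<epsilon>)"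
      by (subst nn_integral_add) (auto simp: \<gamma>.emeasure_space_1)
    also have "\<dots> \<le> (wdist p M Q + ennreal \<epsilon>) + ennreal (3 * \<epsilon>)"
      using le by (intro add_right_mono) auto
    also have "\<dots> = wdist p M Q + ennreal (4 * \<epsilon>)"
      using \<epsilon> by (simp add: add.assoc ennreal_plus[symmetric] del: ennreal_plus)
    finally show ?thesis using g by blast
  qed
  obtain g1 where g1: "finite_plan A (\<lambda>a. measure P (T -` {a} \<inter> space P)) (\<lambda>a. measure Q (T -` {a} \<inter> space Q)) g1"
    "ennreal (plan_cost A (\<lambda>a b. e a b + \<epsilon>) g1) \<le> wdist p P Q + ennreal (4 * \<epsilon>)"
    using discretise[OF P] fin by auto
  obtain g2 where g2: "finite_plan A (\<lambda>a. measure R (T -` {a} \<inter> space R)) (\<lambda>a. measure Q (T -` {a} \<inter> space Q)) g2"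
    "ennreal (plan_cost A (\<lambda>a b. e a b + \<epsilon>) g2) \<le> wdist p R Q + ennreal (4 * \<epsilon>)"
    using discretise[OF R] fin by auto
  obtain g where g: "finite_plan A (\<lambda>a. measure P (T -` {a} \<inter> space P)) (\<lambda>a. measure R (T -` {a} \<inter> space R)) g"
    "plan_cost A (\<lambda>a c. e a c + 2 * \<epsilon>) g \<le> plan_cost A (\<lambda>a b. e a b + \<epsilon>) g1 + plan_cost A (\<lambda>a b. e a b + \<epsilon>) g2"
  proof (rule finite_plan_glue[OF A g1(1) g2(1)])
    fix a b c
    have "pnorm p (\<rho> a - \<rho> c) \<le> pnorm p (\<rho> a - \<rho> b) + pnorm p (\<rho> b - \<rho> c)"
      using pnorm_triangle[OF p, of "\<rho> a - \<rho> b" "\<rho> b - \<rho> c"] by simp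
    then show "e a c + 2 * \<epsilon> \<le> (e a b + \<epsilon>) + (e c b + \<epsilon>)"
      by (simp add: e_def pnorm_commute[of p "\<rho> b" "\<rho> c"])
  qed
  have cost_nonneg: "0 \<le> plan_cost A (\<lambda>a b. e a b + \<epsilon>) h" if "finite_plan A u v h" for u v h
    unfolding plan_cost_def using that \<epsilon> finite_plan_le(1)[OF A that]
    by (intro sum_nonneg mult_nonneg_nonneg) (auto simp: e_def pnorm_nonneg)
  have "wdist p P R \<le> ennreal (plan_cost A (\<lambda>a c. e a c + 2 * \<epsilon>) g)"
  proof (rule wdist_le_plan_cost[OF sp(1)[OF P] sp(1)[OF R] A T[OF P] T[OF R] g(1)])
    show "0 \<le> e a b + 2 * \<epsilon>" for a b using \<epsilon> by (simp add: e_def pnorm_nonneg)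
    fix s t assume "s \<in> space P" "t \<in> space R"
    then have st: "s \<in> \<Xi>" "t \<in> \<Xi>" using sp(2)[OF P] sp(2)[OF R] by auto
    let ?s = "\<rho> (T s)" and ?t = "\<rho> (T t)"
    have "pnorm p (s - t) = pnorm p ((s - ?s) + (?s - ?t) + (?t - t))" by simp
    also have "\<dots> \<le> pnorm p (s - ?s) + pnorm p (?s - ?t) + pnorm p (t - ?t)"
      using pnorm_triangle[OF p, of "(s - ?s) + (?s - ?t)" "?t - t"]
        pnorm_triangle[OF p, of "s - ?s" "?s - ?t"] pnorm_commute[of p ?t t] by linarith
    finally show "pnorm p (s - t) \<le> e (T s) (T t) + 2 * \<epsilon>"
      using near[OF st(1)] near[OF st(2)] by (simp add: e_def)
  qed
  also have "\<dots> \<le> ennreal (plan_cost A (\<lambda>a b. e a b + \<epsilon>) g1) + ennreal (plan_cost A (\<lambda>a b. e a b + \<epsilon>) g2)"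
    using g(2) cost_nonneg[OF g1(1)] cost_nonneg[OF g2(1)]
    by (simp add: ennreal_plus[symmetric] ennreal_leI del: ennreal_plus)
  also have "\<dots> \<le> (wdist p P Q + ennreal (4 * \<epsilon>)) + (wdist p R Q + ennreal (4 * \<epsilon>))"
    by (intro add_mono g1(2) g2(2))
  also have "\<dots> = wdist p P Q + wdist p R Q + (ennreal (4 * \<epsilon>) + ennreal (4 * \<epsilon>))"
    by (simp only: add_ac)
  also have "ennreal (4 * \<epsilon>) + ennreal (4 * \<epsilon>) = ennreal \<epsilon>'"
    using \<epsilon> by (simp add: \<epsilon>_def ennreal_plus[symmetric] del: ennreal_plus)
  finally show "wdist p P R \<le> wdist p P Q + wdist p R Q + ennreal \<epsilon>'" .
qed

section \<open>The Wasserstein distance and the masses of dyadic cells\<close>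

text \<open>
  Expresses the total variation distance through a single set, to which a tail bound for probabilities applies.
\<close>

lemma half_sum_abs_diff:
  fixes u v :: "'a \<Rightarrow> real"
  assumes "finite C" "sum u C = sum v C"
  shows "(\<Sum>c\<in>C. \<bar>u c - v c\<bar>) / 2 = (\<Sum>c\<in>{c\<in>C. v c < u c}. u c - v c)"
proof -
  have "(\<Sum>c\<in>C. \<bar>u c - v c\<bar>) = (\<Sum>c\<in>C. 2 * (if v c < u c then u c - v c else 0) - (u c - v c))"
    by (intro sum.cong) auto
  also have "\<dots> = 2 * (\<Sum>c\<in>{c\<in>C. v c < u c}. u c - v c) - (sum u C - sum v C)"
    unfolding sum.inter_filter[OF assms(1)] by (simp add: sum_subtractf sum_distrib_left)
  finally show ?thesis using assms(2) by simp
qed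

lemma sum_fibre_masses:
  assumes M: "prob_space M" and A: "finite A" and T: "T \<in> measurable M (count_space A)" and S: "finite S"
  shows "(\<Sum>c\<in>S. cell_mass A \<tau> (\<lambda>a. measure M (T -` {a} \<inter> space M)) c)
    = measure M {s \<in> space M. \<tau> (T s) \<in> S}"
proof -
  interpret prob_space M by fact
  define A' where "A' = {a\<in>A. \<tau> a \<in> S}"
  have A': "finite A'" "A' \<subseteq> A" using A by (auto simp: A'_def)
  have "(\<Sum>c\<in>S. cell_mass A \<tau> (\<lambda>a. measure M (T -` {a} \<inter> space M)) c)
    = (\<Sum>c\<in>S. \<Sum>a\<in>{a\<in>A'. \<tau> a = c}. measure M (T -` {a} \<inter> space M))"
    unfolding cell_mass_def A'_def by (intro sum.cong) auto
  also have "\<dots> = (\<Sum>a\<in>A'. measure M (T -` {a} \<inter> space M))"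
    using A' S by (intro sum.group) (auto simp: A'_def)
  also have "\<dots> = measure M (\<Union>a\<in>A'. T -` {a} \<inter> space M)"
    using A' T by (intro finite_measure_finite_Union[symmetric])
      (auto simp: disjoint_family_on_def intro: measurable_sets)
  also have "(\<Union>a\<in>A'. T -` {a} \<inter> space M) = {s \<in> space M. \<tau> (T s) \<in> S}"
    using measurable_space[OF T] by (auto simp: A'_def)
  finally show ?thesis .
qed

text \<open>
  The assumption on the deviations is one-sided because the total variation distance on the cells of a level
  is attained as an excess of \<open>P\<close> over \<open>R\<close> on some set of cells. The diameter of a cell
  of level \<open>l\<close> is at most \<open>D / 2 ^ l\<close>.
\<close>

lemma wdist_le_dyadic_discrepancy:
  fixes P R :: "(real ^ 'k) measure"
  assumes p: "1 \<le> p" and B: "0 < B" and \<Xi>: "\<And>s i. s \<in> \<Xi> \<Longrightarrow> \<bar>s $ i\<bar> < B"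
    and P: "P \<in> borel_probs \<Xi>" and R: "R \<in> borel_probs \<Xi>"
    and e: "\<And>l S. 1 \<le> l \<Longrightarrow> l \<le> L \<Longrightarrow> S \<subseteq> labels (2 ^ l) \<Longrightarrow>
        measure P (block B L l S \<inter> \<Xi>) \<le> measure R (block B L l S \<inter> \<Xi>) + e l"
  defines "D \<equiv> 2 * B * real CARD('k)"
  shows "wdist p P R \<le> ennreal (D / 2 ^ L + (\<Sum>l<L. D / 2 ^ l * e (Suc l)))"
proof -
  have sp: "prob_space P" "space P = \<Xi>" "sets P = sets (restrict_space borel \<Xi>)"
    "prob_space R" "space R = \<Xi>" "sets R = sets (restrict_space borel \<Xi>)"
    using P R by (auto simp: borel_probs_def)
  define T where "T = (grid B (2 ^ L) :: real ^ 'k \<Rightarrow> _)"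
  define A where "A = (labels (2 ^ L) :: ('k \<Rightarrow> int) set)"
  define \<tau> where "\<tau> l = (coarsen (2 ^ (L - l)) :: ('k \<Rightarrow> int) \<Rightarrow> _)" for l
  define \<delta> where "\<delta> l = D / 2 ^ l" for l
  \<comment> \<open>The distance of two finest cells is estimated on the best level on which they share a cell;
    level \<open>0\<close> always qualifies.\<close>
  define c where "c a b = Min (\<delta> ` {l. l \<le> L \<and> \<tau> l a = \<tau> l b})" for a b
  define u where "u = (\<lambda>a. measure P (T -` {a} \<inter> space P))"
  define v where "v = (\<lambda>a. measure R (T -` {a} \<inter> space R))"
  have A: "finite A" by (simp add: A_def)
  have \<delta>: "0 \<le> \<delta> l" for l using B by (simp add: \<delta>_def D_def)
  have T: "T \<in> measurable P (count_space A)" "T \<in> measurable R (count_space A)"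
    unfolding T_def A_def using \<Xi> sp by (auto intro!: measurable_grid[where \<Xi> = \<Xi>])
  have \<tau>_labels: "\<tau> l a \<in> labels (2 ^ l)" if "l \<le> L" "a \<in> A" for l a
    using coarsen_labels[of "2 ^ (L - l)" a "2 ^ l"] that by (simp add: \<tau>_def A_def flip: power_add)
  have root: "\<tau> 0 a = \<tau> 0 b" if "a \<in> A" "b \<in> A" for a b
    using that by (simp add: \<tau>_def A_def coarsen_self)
  have refine: "\<tau> l a = \<tau> l b" if "l \<le> m" "m \<le> L" "\<tau> m a = \<tau> m b" for l m a b
  proof -
    have "(2::nat) ^ (L - l) = 2 ^ (L - m) * 2 ^ (m - l)" using that by (simp flip: power_add)
    then have "\<tau> l x = coarsen (2 ^ (m - l)) (\<tau> m x)" for x by (simp add: \<tau>_def coarsen_coarsen)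
    with that(3) show ?thesis by simp
  qed
  have close: "pnorm p (s - t) \<le> \<delta> l" if "l \<le> L" "\<tau> l (T s) = \<tau> l (T t)" for s t l
  proof -
    have "\<bar>(s - t) $ i\<bar> \<le> 2 * B / real (2 ^ l)" for i
    proof (rule coarsen_grid_close[OF B, of "2 ^ (L - l)"])
      have "(2::nat) ^ (L - l) * 2 ^ l = 2 ^ L" using that(1) by (simp flip: power_add)
      then show "coarsen (2 ^ (L - l)) (grid B (2 ^ (L - l) * 2 ^ l) s)
          = coarsen (2 ^ (L - l)) (grid B (2 ^ (L - l) * 2 ^ l) t)"
        using that(2) by (simp add: \<tau>_def T_def)
    qed auto
    then have "pnorm p (s - t) \<le> real CARD('k) * (2 * B / real (2 ^ l))" by (rule pnorm_le_card[OF p])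
    then show ?thesis by (simp add: \<delta>_def D_def mult_ac)
  qed
  have uv_total: "sum u A = 1" "sum v A = 1"
    using sum_measure_fibres[OF sp(1) A T(1) sets.top] sum_measure_fibres[OF sp(4) A T(2) sets.top]
      prob_space.prob_space[OF sp(1)] prob_space.prob_space[OF sp(4)] by (simp_all add: u_def v_def)
  have "\<exists>g. finite_plan A u v g \<and> plan_cost A c g \<le> \<delta> L * sum u A + (\<Sum>l<L. \<delta> l *
            ((\<Sum>x\<in>\<tau> (Suc l) ` A. \<bar>cell_mass A (\<tau> (Suc l)) u x - cell_mass A (\<tau> (Suc l)) v x\<bar>) / 2))"
  proof (rule multiscale_plan[OF A])
    show "0 \<le> u a" "0 \<le> v a" for a by (simp_all add: u_def v_def)
    show "sum u A = sum v A" by (simp only: uv_total)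
    show "\<tau> l a = \<tau> l b" if "l \<le> m" "m \<le> L" "\<tau> m a = \<tau> m b" for l m a b
      using that by (rule refine)
    show "\<tau> 0 a = \<tau> 0 b" if "a \<in> A" "b \<in> A" for a b using that by (rule root)
    show "c a b \<le> \<delta> l" if "l \<le> L" "\<tau> l a = \<tau> l b" for l a b
      unfolding c_def using that by (intro Min_le) auto
    show "0 \<le> \<delta> l" for l by (rule \<delta>)
  qed
  then obtain g where g: "finite_plan A u v g" and g_cost: "plan_cost A c g \<le> \<delta> L * sum u A + (\<Sum>l<L. \<delta> l *
            ((\<Sum>x\<in>\<tau> (Suc l) ` A. \<bar>cell_mass A (\<tau> (Suc l)) u x - cell_mass A (\<tau> (Suc l)) v x\<bar>) / 2))"
    by (elim exE conjE)
  have half: "(\<Sum>x\<in>\<tau> l ` A. \<bar>cell_mass A (\<tau> l) u x - cell_mass A (\<tau> l) v x\<bar>) / 2 \<le> e l"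
    if l: "1 \<le> l" "l \<le> L" for l
  proof -
    define S where "S = {x \<in> \<tau> l ` A. cell_mass A (\<tau> l) v x < cell_mass A (\<tau> l) u x}"
    have S: "finite S" "S \<subseteq> labels (2 ^ l)" using A \<tau>_labels[OF l(2)] by (auto simp: S_def)
    have bl: "{s \<in> \<Xi>. \<tau> l (T s) \<in> S} = block B L l S \<inter> \<Xi>" by (auto simp: block_def \<tau>_def T_def)
    have "(\<Sum>x\<in>\<tau> l ` A. \<bar>cell_mass A (\<tau> l) u x - cell_mass A (\<tau> l) v x\<bar>) / 2
        = (\<Sum>x\<in>S. cell_mass A (\<tau> l) u x - cell_mass A (\<tau> l) v x)"
      unfolding S_def using A uv_total by (intro half_sum_abs_diff) (auto simp: sum_cell_mass)
    also have "\<dots> = measure P (block B L l S \<inter> \<Xi>) - measure R (block B L l S \<inter> \<Xi>)"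
      using sum_fibre_masses[OF sp(1) A T(1) S(1), of "\<tau> l"] sum_fibre_masses[OF sp(4) A T(2) S(1), of "\<tau> l"]
      by (simp add: sum_subtractf u_def v_def sp(2,5) bl)
    finally show ?thesis using e[OF l S(2)] by simp
  qed
  have "wdist p P R \<le> ennreal (plan_cost A c g)"
  proof (rule wdist_le_plan_cost[OF sp(1,4) A T])
    show "finite_plan A (\<lambda>a. measure P (T -` {a} \<inter> space P)) (\<lambda>a. measure R (T -` {a} \<inter> space R)) g"
      using g by (simp add: u_def v_def)
    show "0 \<le> c a b" if "a \<in> A" "b \<in> A" for a b
      unfolding c_def using root[OF that] \<delta> by (subst Min_ge_iff) auto
    show "pnorm p (s - t) \<le> c (T s) (T t)" if "s \<in> space P" "t \<in> space R" for s t
    proof -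
      have "T s \<in> A" "T t \<in> A" using measurable_space[OF T(1)] measurable_space[OF T(2)] that by auto
      then show ?thesis unfolding c_def using root close by (subst Min_ge_iff) auto
    qed
  qed
  also have "plan_cost A c g \<le> D / 2 ^ L + (\<Sum>l<L. D / 2 ^ l * e (Suc l))"
  proof -
    have "(\<Sum>l<L. \<delta> l * ((\<Sum>x\<in>\<tau> (Suc l) ` A. \<bar>cell_mass A (\<tau> (Suc l)) u x - cell_mass A (\<tau> (Suc l)) v x\<bar>) / 2))
      \<le> (\<Sum>l<L. \<delta> l * e (Suc l))"
      using \<delta> half by (intro sum_mono mult_left_mono) auto
    then show ?thesis using g_cost uv_total by (simp add: \<delta>_def)
  qed
  finally show ?thesis by (simp add: ennreal_leI)
qed

section \<open>Mixtures and empirical measures\<close>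

lemma
  fixes \<Xi> :: "(real ^ 'k) set"
  assumes s: "s \<in> {1..N} \<rightarrow> \<Xi>"
  shows space_empirical: "space (empirical \<Xi> N x s y) = \<Xi>"
    and sets_empirical: "sets (empirical \<Xi> N x s y) = sets (restrict_space borel \<Xi>)"
    and emeasure_empirical: "A \<in> sets (restrict_space borel \<Xi>) \<Longrightarrow> emeasure (empirical \<Xi> N x s y) A
      = ennreal ((\<Sum>n\<in>{n\<in>{1..N}. x n = y}. indicator A (s n)) / real (mult_at N x y))"
proof -
  show "space (empirical \<Xi> N x s y) = \<Xi>" "sets (empirical \<Xi> N x s y) = sets (restrict_space borel \<Xi>)"
    by (simp_all add: empirical_def)
  assume A: "A \<in> sets (restrict_space borel \<Xi>)"
  let ?I = "{n\<in>{1..N}. x n = y}"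
  have "emeasure (empirical \<Xi> N x s y) A = (\<Sum>n\<in>?I. ennreal (1 / real (mult_at N x y)) * indicator A (s n))"
    unfolding empirical_def using A by (subst emeasure_mixture) auto
  also have "\<dots> = (\<Sum>n\<in>?I. ennreal (indicator A (s n) / real (mult_at N x y)))"
    by (intro sum.cong) (auto simp: indicator_def)
  also have "\<dots> = ennreal ((\<Sum>n\<in>?I. indicator A (s n)) / real (mult_at N x y))"
    by (subst sum_ennreal) (auto simp: sum_divide_distrib)
  finally show "emeasure (empirical \<Xi> N x s y) A
      = ennreal ((\<Sum>n\<in>?I. indicator A (s n)) / real (mult_at N x y))" .
qed

lemma mult_at_pos: "y \<in> x ` {1..N} \<Longrightarrow> 0 < mult_at N x y"
  unfolding mult_at_def by (subst card_gt_0_iff) auto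

lemma empirical_borel_probs:
  fixes \<Xi> :: "(real ^ 'k) set"
  assumes s: "s \<in> {1..N} \<rightarrow> \<Xi>" and y: "y \<in> x ` {1..N}"
  shows "empirical \<Xi> N x s y \<in> borel_probs \<Xi>"
proof -
  have top: "\<Xi> \<in> sets (restrict_space borel \<Xi>)" using sets.top[of "restrict_space borel \<Xi>"]
    by (simp add: space_restrict_space)
  have "(\<Sum>n\<in>{n\<in>{1..N}. x n = y}. indicator \<Xi> (s n) :: real) = (\<Sum>n\<in>{n\<in>{1..N}. x n = y}. 1)"
    using s by (intro sum.cong) (auto simp: Pi_iff)
  also have "\<dots> = real (mult_at N x y)" by (simp add: mult_at_def)
  finally have "emeasure (empirical \<Xi> N x s y) \<Xi> = 1"
    unfolding emeasure_empirical[OF s top] using mult_at_pos[OF y] by simp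
  then show ?thesis
    using s by (auto simp: borel_probs_def space_empirical sets_empirical intro!: prob_spaceI)
qed

lemma mixture_borel_probs:
  fixes \<Xi> :: "(real ^ 'k) set"
  assumes I: "finite I" and w: "\<And>i. i \<in> I \<Longrightarrow> 0 \<le> w i" "sum w I = 1"
    and \<mu>: "\<And>i. i \<in> I \<Longrightarrow> \<mu> i \<in> borel_probs \<Xi>"
  shows "mixture \<Xi> I w \<mu> \<in> borel_probs \<Xi>"
proof -
  have top: "\<Xi> \<in> sets (restrict_space borel \<Xi>)" using sets.top[of "restrict_space borel \<Xi>"]
    by (simp add: space_restrict_space)
  have "emeasure (mixture \<Xi> I w \<mu>) \<Xi> = (\<Sum>i\<in>I. ennreal (w i) * emeasure (\<mu> i) \<Xi>)"
    using \<mu> top by (subst emeasure_mixture) (auto simp: borel_probs_def)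
  also have "\<dots> = (\<Sum>i\<in>I. ennreal (w i))"
    using \<mu> prob_space.emeasure_space_1 by (intro sum.cong) (force simp: borel_probs_def)+
  also have "\<dots> = 1" using w by (subst sum_ennreal) auto
  finally show ?thesis by (auto simp: borel_probs_def intro!: prob_spaceI)
qed

text \<open>
  The interpolation has weights of this kind at the decisions of the data.
\<close>

lemma mixture_single:
  fixes \<Xi> :: "(real ^ 'k) set"
  assumes I: "finite I" "j \<in> I" and w: "w j = 1" "\<And>i. i \<in> I \<Longrightarrow> i \<noteq> j \<Longrightarrow> w i = 0"
    and \<mu>: "\<And>i. i \<in> I \<Longrightarrow> sets (\<mu> i) = sets (restrict_space borel \<Xi>)"
  shows "mixture \<Xi> I w \<mu> = \<mu> j"
proof (rule measure_eqI)
  show "sets (mixture \<Xi> I w \<mu>) = sets (\<mu> j)" using \<mu>[OF I(2)] by simp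
  fix A assume "A \<in> sets (mixture \<Xi> I w \<mu>)"
  then have "emeasure (mixture \<Xi> I w \<mu>) A = (\<Sum>i\<in>I. ennreal (w i) * emeasure (\<mu> i) A)"
    using \<mu> by (subst emeasure_mixture) auto
  also have "\<dots> = emeasure (\<mu> j) A"
    using I w by (subst sum.remove[OF I]) auto
  finally show "emeasure (mixture \<Xi> I w \<mu>) A = emeasure (\<mu> j) A" .
qed

lemma prob_space_sample_law:
  "(\<And>n. n \<in> {1..N} \<Longrightarrow> Q (x n) \<in> borel_probs \<Xi>) \<Longrightarrow> prob_space (sample_law N x Q)"
  unfolding sample_law_def by (rule prob_space_PiM) (auto simp: borel_probs_def)

lemma sample_in_support:
  assumes "\<And>n. n \<in> {1..N} \<Longrightarrow> Q (x n) \<in> borel_probs \<Xi>" "s \<in> space (sample_law N x Q)"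
  shows "s \<in> {1..N} \<rightarrow> \<Xi>"
proof
  fix n assume n: "n \<in> {1..N}"
  then have "s n \<in> space (Q (x n))"
    using assms(2) by (auto simp: sample_law_def space_PiM PiE_def Pi_def)
  then show "s n \<in> \<Xi>" using assms(1)[OF n] by (simp add: borel_probs_def)
qed

section \<open>Concentration of the empirical measure\<close>

text \<open>
  A family is independent if its joint law is the product of the marginal laws; here the joint law is
  the product measure by construction.
\<close>

lemma indep_vars_coordinates:
  assumes I: "I \<noteq> {}" and M: "\<And>i. i \<in> I \<Longrightarrow> prob_space (M i)"
  shows "prob_space.indep_vars (Pi\<^sub>M I M) M (\<lambda>i \<omega>. \<omega> i) I"
proof -
  interpret prob_space "Pi\<^sub>M I M" using M by (rule prob_space_PiM)
  have "distr (Pi\<^sub>M I M) (Pi\<^sub>M I M) (\<lambda>\<omega>. \<lambda>i\<in>I. \<omega> i) = distr (Pi\<^sub>M I M) (Pi\<^sub>M I M) (\<lambda>\<omega>. \<omega>)"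
    by (intro distr_cong) (auto simp: space_PiM)
  also have "\<dots> = Pi\<^sub>M I M" by (rule distr_id)
  also have "\<dots> = Pi\<^sub>M I (\<lambda>i. distr (Pi\<^sub>M I M) (M i) (\<lambda>\<omega>. \<omega> i))"
    using M by (intro PiM_cong) (auto simp: distr_PiM_component)
  finally show ?thesis
    by (subst indep_vars_iff_distr_eq_PiM'[OF I]) auto
qed

text \<open>
  The empirical mass of \<open>A\<close> is the average of the indicators of \<open>A\<close> at the samples drawn at \<open>y\<close>. These are
  independent with values in the unit interval and mean \<open>Q y (A)\<close>, so Hoeffding's inequality applies.
\<close>

lemma empirical_mass_tail:
  fixes \<Xi> :: "(real ^ 'k) set" and Q :: "'x \<Rightarrow> (real ^ 'k) measure"
  assumes Q: "\<And>n. n \<in> {1..N} \<Longrightarrow> Q (x n) \<in> borel_probs \<Xi>" and y: "y \<in> x ` {1..N}"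
    and A: "A \<in> sets (restrict_space borel \<Xi>)" and \<epsilon>: "0 \<le> \<epsilon>"
  shows "{s \<in> space (sample_law N x Q). measure (empirical \<Xi> N x s y) A \<ge> measure (Q y) A + \<epsilon>}
          \<in> sets (sample_law N x Q)" (is "?E \<in> _")
    and "measure (sample_law N x Q) {s \<in> space (sample_law N x Q).
            measure (empirical \<Xi> N x s y) A \<ge> measure (Q y) A + \<epsilon>} \<le> exp (- 2 * real (mult_at N x y) * \<epsilon>\<^sup>2)"
proof -
  let ?M = "sample_law N x Q" and ?n = "real (mult_at N x y)"
  define I where "I = {n\<in>{1..N}. x n = y}"
  have I: "finite I" "I \<subseteq> {1..N}" "card I = mult_at N x y" "\<And>i. i \<in> I \<Longrightarrow> x i = y"
    by (auto simp: I_def mult_at_def)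
  have n: "0 < ?n" using mult_at_pos[OF y] by simp
  interpret prob_space ?M using Q by (rule prob_space_sample_law)
  have Qn: "prob_space (Q (x n))" "sets (Q (x n)) = sets (restrict_space borel \<Xi>)" if "n \<in> {1..N}" for n
    using Q[OF that] by (auto simp: borel_probs_def)
  define X where "X i s = (indicator A (s i) :: real)" for i and s :: "nat \<Rightarrow> real ^ 'k"
  have ind: "indicator A \<in> borel_measurable (Q (x i))" if "i \<in> {1..N}" for i
    using A Qn(2)[OF that] by (intro borel_measurable_indicator) simp
  have "indep_vars (\<lambda>i. Q (x i)) (\<lambda>i s. s i) {1..N}"
    unfolding sample_law_def using y Qn(1) by (intro indep_vars_coordinates) auto
  then have "indep_vars (\<lambda>_. borel) (\<lambda>i s. indicator A (s i) :: real) {1..N}"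
    by (rule indep_vars_compose2) (rule ind)
  then have indep: "indep_vars (\<lambda>_. borel) X I" 
    unfolding X_def using I(2) by (rule indep_vars_subset)
  interpret Hoeffding_ineq ?M I X "\<lambda>_. 0" "\<lambda>_. 1" "\<Sum>i\<in>I. expectation (X i)"
    by unfold_locales (auto simp: I indep X_def indicator_def)
  have "expectation (X i) = measure (Q y) A" if i: "i \<in> I" for i
  proof -
    have i': "i \<in> {1..N}" using i I(2) by auto
    have "measure (Q (x i)) A = (\<integral>t. indicator A t \<partial>Q (x i))"
      using A Qn(2)[OF i'] sets.sets_into_space[of A "Q (x i)"] by (simp add: Int_absorb2)
    also have "\<dots> = (\<integral>t. indicator A t \<partial>distr ?M (Q (x i)) (\<lambda>s. s i))"
      unfolding sample_law_def using i' Qn(1) by (subst distr_PiM_component) auto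
    also have "\<dots> = expectation (X i)"
      unfolding X_def using ind[OF i'] i' by (intro integral_distr) (auto simp: sample_law_def)
    finally show ?thesis using I(4)[OF i] by simp
  qed
  then have mean: "(\<Sum>i\<in>I. expectation (X i)) = ?n * measure (Q y) A"
    using I(3) by simp
  have E_eq: "?E = {s \<in> space ?M. (\<Sum>i\<in>I. X i s) \<ge> (\<Sum>i\<in>I. expectation (X i)) + ?n * \<epsilon>}"
  proof (intro Collect_cong conj_cong refl)
    fix s assume "s \<in> space ?M"
    with Q have s: "s \<in> {1..N} \<rightarrow> \<Xi>" by (rule sample_in_support)
    have "measure (empirical \<Xi> N x s y) A = (\<Sum>i\<in>I. X i s) / ?n"
      unfolding measure_def emeasure_empirical[OF s A] by (simp add: sum_nonneg X_def I_def)
    then have sum_eq: "(\<Sum>i\<in>I. X i s) = ?n * measure (empirical \<Xi> N x s y) A"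
      using n by simp
    show "(measure (Q y) A + \<epsilon> \<le> measure (empirical \<Xi> N x s y) A)
        = ((\<Sum>i\<in>I. expectation (X i)) + ?n * \<epsilon> \<le> (\<Sum>i\<in>I. X i s))"
      unfolding sum_eq mean distrib_left[symmetric] using n by simp
  qed
  show "?E \<in> sets ?M"
    unfolding E_eq using random_variable by measurable
  have "prob ?E \<le> exp (-2 * (?n * \<epsilon>)\<^sup>2 / (\<Sum>i\<in>I. (1 - 0)\<^sup>2))"
    unfolding E_eq by (rule Hoeffding_ineq_ge) (use \<epsilon> n I(3) in auto)
  also have "-2 * (?n * \<epsilon>)\<^sup>2 / (\<Sum>i\<in>I. (1 - 0)\<^sup>2) = - 2 * ?n * \<epsilon>\<^sup>2"
    using n I(3) by (simp add: power2_eq_square)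
  finally show "prob ?E \<le> exp (- 2 * ?n * \<epsilon>\<^sup>2)" .
qed

text \<open>
  The product \<open>2 ^ - l * (3/8) ^ (L - l - 1)\<close> is \<open>2 * 2 ^ - L * (3/4) ^ (L - l - 1)\<close>, a geometric sequence
  decreasing from the finest level. Therefore the cost of all levels is comparable to the finest one.
\<close>

lemma geometric_discrepancy_sum:
  fixes D :: real
  assumes "0 \<le> D"
  shows "D / 2 ^ L + (\<Sum>l<L. D / 2 ^ l * (3 / 8) ^ (L - Suc l)) \<le> 9 * D / 2 ^ L"
proof -
  have "(\<Sum>l<L. D / 2 ^ l * (3 / 8) ^ (L - Suc l)) = (\<Sum>l<L. 2 * D / 2 ^ L * (3 / 4) ^ (L - Suc l))"
  proof (intro sum.cong refl)
    fix l assume "l \<in> {..<L}"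
    then have L: "L = Suc l + (L - Suc l)" by simp
    have "(3 / 8 :: real) ^ j = (3 / 4) ^ j / 2 ^ j" for j :: nat
      by (simp add: power_divide[symmetric])
    then have "D / 2 ^ l * (3 / 8) ^ (L - Suc l) = 2 * D / (2 ^ Suc l * 2 ^ (L - Suc l)) * (3 / 4) ^ (L - Suc l)"
      by simp
    also have "(2::real) ^ Suc l * 2 ^ (L - Suc l) = 2 ^ L" using L by (metis power_add)
    finally show "D / 2 ^ l * (3 / 8) ^ (L - Suc l) = 2 * D / 2 ^ L * (3 / 4) ^ (L - Suc l)" .
  qed
  also have "\<dots> = 2 * D / 2 ^ L * (\<Sum>j<L. (3 / 4) ^ j)"
    by (simp only: sum_distrib_left[symmetric] sum.nat_diff_reindex[of "\<lambda>j. (3 / 4 :: real) ^ j"])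
  also have "\<dots> \<le> 2 * D / 2 ^ L * 4"
    using assms by (intro mult_left_mono) (auto simp: sum_gp_strict)
  finally show ?thesis by (simp add: field_simps)
qed

text \<open>
  With \<open>\<kappa> = n / 2 ^ (k * L)\<close>, the Hoeffding exponent at level \<open>l\<close> is at least \<open>2 * \<kappa> * 2 ^ (k * l)\<close> because
  \<open>(3/8)\<^sup>2 \<ge> 1/8 \<ge> 1/2 ^ k\<close>. For \<open>\<kappa> \<ge> 1\<close> one half of it absorbs the number \<open>2 ^ 2 ^ (k * l)\<close> of sets of
  cells, and the other half leaves \<open>exp (- \<kappa>)\<close> with a factor that is summable over \<open>l\<close>. The ratio \<open>3/8\<close> is a
  compromise: below \<open>1/2\<close>, so that the transport costs form a convergent geometric series, and with square
  at least \<open>1/8\<close>. In dimension two, with \<open>1/4\<close> in place of \<open>1/8\<close>, there is no such ratio.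
\<close>

lemma level_tail_bound:
  fixes n :: real
  assumes k: "3 \<le> k" and l: "l \<le> L" and n: "2 ^ (k * L) \<le> n"
  defines "\<kappa> \<equiv> n / 2 ^ (k * L)"
  shows "2 ^ (2 ^ l) ^ k * exp (- 2 * n * ((3 / 8) ^ (L - l))\<^sup>2) \<le> exp (- \<kappa>) * (1 / 2) ^ l"
proof -
  have \<kappa>: "1 \<le> \<kappa>" using n by (simp add: \<kappa>_def)
  have e: "(1 / 2 ^ k) ^ (L - l) \<le> ((3 / 8 :: real) ^ (L - l))\<^sup>2"
  proof -
    have "(1 / 2 :: real) ^ k \<le> (1 / 2) ^ 3" using k by (intro power_decreasing) auto
    also have "\<dots> \<le> (3 / 8)\<^sup>2" by (simp add: power2_eq_square power3_eq_cube)
    finally have "(1 / 2 ^ k :: real) \<le> (3 / 8)\<^sup>2" by (simp add: power_one_over)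
    then have "(1 / 2 ^ k :: real) ^ (L - l) \<le> ((3 / 8)\<^sup>2) ^ (L - l)" by (intro power_mono) auto
    then show ?thesis by (simp only: power_mult[symmetric] mult.commute)
  qed
  have "(2::real) ^ (k * L) = 2 ^ (k * l) * (2 ^ k) ^ (L - l)"
    using l by (simp add: power_mult[symmetric] power_add[symmetric] distrib_left[symmetric])
  then have "\<kappa> * 2 ^ (k * l) = n * (1 / 2 ^ k) ^ (L - l)"
    by (simp add: \<kappa>_def power_one_over)
  also have "\<dots> \<le> n * ((3 / 8) ^ (L - l))\<^sup>2"
  proof (rule mult_left_mono[OF e])
    show "0 \<le> n" using n by (meson order_trans zero_le_numeral zero_le_power)
  qed
  finally have tail: "\<kappa> * 2 ^ (k * l) \<le> n * ((3 / 8) ^ (L - l))\<^sup>2" .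
  define m where "m = (2::nat) ^ (k * l)"
  have m: "(2 ^ l) ^ k = m" by (simp add: m_def power_mult[symmetric] mult.commute)
  have "l + 1 \<le> (2::nat) ^ l" by (simp add: Suc_le_eq)
  also have "\<dots> \<le> m" unfolding m_def using k by (intro power_increasing) auto
  finally have "real l + 1 \<le> real m" by linarith
  have pow2: "2 ^ j \<le> exp (real j)" for j :: nat
  proof -
    have "2 ^ j \<le> exp (1::real) ^ j" using exp_ge_add_one_self[of 1] by (intro power_mono) auto
    then show ?thesis by (simp add: exp_of_nat_mult[symmetric])
  qed
  have "2 ^ m * exp (- 2 * n * ((3 / 8) ^ (L - l))\<^sup>2) \<le> exp (real m) * exp (- 2 * (\<kappa> * real m))"
    using tail by (intro mult_mono pow2) (auto simp: m_def)
  also have "\<dots> = exp (real m - 2 * (\<kappa> * real m))" by (simp add: exp_add[symmetric])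
  also have "\<dots> \<le> exp (- \<kappa> - real l)"
  proof -
    have "1 * real m \<le> \<kappa> * real m" using \<kappa> by (intro mult_right_mono) auto
    moreover have "\<kappa> * (real l + 1) \<le> \<kappa> * real m" using \<kappa> \<open>real l + 1 \<le> real m\<close> by (intro mult_left_mono) auto
    moreover have "1 * real l \<le> \<kappa> * real l" using \<kappa> by (intro mult_right_mono) auto
    ultimately show ?thesis by (simp add: distrib_left)
  qed
  also have "\<dots> = exp (- \<kappa>) * (1 / exp (real l))" by (simp add: exp_diff)
  also have "\<dots> \<le> exp (- \<kappa>) * (1 / 2 ^ l)"
    using pow2[of l] by (intro mult_left_mono divide_left_mono) auto
  finally show ?thesis by (simp add: m power_one_over)
qed

text \<open>
  The finest level \<open>L\<close> is the least one whose resolution yields a transport cost of at most \<open>\<epsilon>\<close>, so that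
  \<open>\<epsilon>\<close> and \<open>2 ^ - L\<close> are comparable unless \<open>L = 0\<close>. If \<open>L = 0\<close>, the diameter of the cube is already
  below \<open>\<epsilon>\<close> and every sample is good. If \<open>n\<close> is less than the number \<open>2 ^ (k * L)\<close> of cells, the claimed
  probability is not positive, due to the factor \<open>3 \<ge> exp 1\<close>. Otherwise the levels are combined by a union bound.
\<close>

lemma empirical_concentration:
  fixes \<Xi> :: "(real ^ 'k) set" and Q :: "'x \<Rightarrow> (real ^ 'k) measure"
  assumes p: "1 \<le> p" and B: "0 < B" and \<Xi>: "\<And>s i. s \<in> \<Xi> \<Longrightarrow> \<bar>s $ i\<bar> < B" and dim: "3 \<le> CARD('k)"
    and Q: "\<And>n. n \<in> {1..N} \<Longrightarrow> Q (x n) \<in> borel_probs \<Xi>" and y: "y \<in> x ` {1..N}" and \<epsilon>: "0 < \<epsilon>"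
  defines "D \<equiv> 2 * B * real CARD('k)"
  shows "\<exists>E\<in>sets (sample_law N x Q).
    E \<subseteq> {s \<in> space (sample_law N x Q). wdist p (empirical \<Xi> N x s y) (Q y) \<le> ennreal \<epsilon>} \<and>
    measure (sample_law N x Q) E \<ge> 1 - 3 * exp (- real (mult_at N x y) * (\<epsilon> / (18 * D)) ^ CARD('k))"
proof -
  let ?M = "sample_law N x Q" and ?n = "real (mult_at N x y)" and ?k = "CARD('k)"
  interpret prob_space ?M using Q by (rule prob_space_sample_law)
  have D: "0 < D" using B by (simp add: D_def)
  have Qy: "Q y \<in> borel_probs \<Xi>" using Q y by auto
  obtain L where L: "9 * D / 2 ^ L \<le> \<epsilon>" and L': "L = 0 \<or> \<epsilon> < 18 * D / 2 ^ L"
  proof -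
    obtain j where j: "9 * D / \<epsilon> < 2 ^ j" using real_arch_pow[of 2 "9 * D / \<epsilon>"] by auto
    define L where "L = (LEAST j. 9 * D / 2 ^ j \<le> \<epsilon>)"
    have "9 * D / 2 ^ j \<le> \<epsilon>" using j \<epsilon> by (simp add: field_simps)
    then have ge: "9 * D / 2 ^ L \<le> \<epsilon>" unfolding L_def by (rule LeastI)
    have less: "\<epsilon> < 18 * D / 2 ^ L" if "L \<noteq> 0"
    proof -
      from that obtain i where i: "L = Suc i" by (cases L) auto
      then have "i < L" by simp
      then have "\<not> 9 * D / 2 ^ i \<le> \<epsilon>" unfolding L_def by (rule not_less_Least)
      then show ?thesis by (simp add: i)
    qed
    show ?thesis by (rule that[OF ge]) (use less in linarith)
  qed
  define e where "e l = (3 / 8 :: real) ^ (L - l)" for l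
  define bad where "bad l S = {s \<in> space ?M. measure (empirical \<Xi> N x s y) (block B L l S \<inter> \<Xi>)
    \<ge> measure (Q y) (block B L l S \<inter> \<Xi>) + e l}" for l S
  have bad: "bad l S \<in> events" "prob (bad l S) \<le> exp (- 2 * ?n * (e l)\<^sup>2)" for l S
  proof -
    have "block B L l S \<inter> \<Xi> \<in> sets (restrict_space borel \<Xi>)" by (rule block_sets) (rule \<Xi>)
    then show "bad l S \<in> events" "prob (bad l S) \<le> exp (- 2 * ?n * (e l)\<^sup>2)"
      unfolding bad_def using Q y by (intro empirical_mass_tail; simp add: e_def)+
  qed
  define Bad where "Bad = (\<Union>l\<in>{1..L}. \<Union>S\<in>Pow (labels (2 ^ l)). bad l S)"
  have Bad: "Bad \<in> events" unfolding Bad_def using bad(1) by (intro sets.finite_UN) auto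
  have good: "wdist p (empirical \<Xi> N x s y) (Q y) \<le> ennreal \<epsilon>" if s: "s \<in> space ?M - Bad" for s
  proof -
    have "s \<in> {1..N} \<rightarrow> \<Xi>" by (rule sample_in_support) (use Q s in auto)
    then have emp: "empirical \<Xi> N x s y \<in> borel_probs \<Xi>" using y by (rule empirical_borel_probs)
    have "wdist p (empirical \<Xi> N x s y) (Q y) \<le> ennreal (D / 2 ^ L + (\<Sum>l<L. D / 2 ^ l * e (Suc l)))"
      unfolding D_def
    proof (rule wdist_le_dyadic_discrepancy[OF p B _ emp Qy])
      show "\<bar>s $ i\<bar> < B" if "s \<in> \<Xi>" for s i using that by (rule \<Xi>)
    next
      fix l and S :: "('k \<Rightarrow> int) set" assume lS: "1 \<le> l" "l \<le> L" "S \<subseteq> labels (2 ^ l)"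
      then have "s \<notin> bad l S" using s by (auto simp: Bad_def)
      then show "measure (empirical \<Xi> N x s y) (block B L l S \<inter> \<Xi>) \<le> measure (Q y) (block B L l S \<inter> \<Xi>) + e l"
        using s by (simp add: bad_def)
    qed
    also have "\<dots> \<le> ennreal \<epsilon>"
      using geometric_discrepancy_sum[of D L] D L unfolding e_def by (intro ennreal_leI) linarith
    finally show ?thesis .
  qed
  define \<kappa> where "\<kappa> = ?n / 2 ^ (?k * L)"
  have le: "?n * (\<epsilon> / (18 * D)) ^ ?k \<le> \<kappa>" if "L \<noteq> 0"
  proof -
    have "(\<epsilon> / (18 * D)) ^ ?k \<le> (1 / 2 ^ L) ^ ?k"
      using L' that \<epsilon> D by (intro power_mono) (auto simp: field_simps)
    then have "?n * (\<epsilon> / (18 * D)) ^ ?k \<le> ?n * (1 / 2 ^ L) ^ ?k" by (intro mult_left_mono) auto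
    also have "(1 / 2 ^ L :: real) ^ ?k = 1 / 2 ^ (?k * L)"
      by (simp add: power_one_over power_mult[symmetric] mult.commute)
    finally show ?thesis by (simp add: \<kappa>_def)
  qed
  consider "L = 0" | "\<kappa> < 1" "L \<noteq> 0" | "1 \<le> \<kappa>" "L \<noteq> 0" by linarith
  then show ?thesis
  proof cases
    case 1
    then have "Bad = {}" by (simp add: Bad_def)
    then show ?thesis using good by (intro bexI[of _ "space ?M"]) (auto simp: prob_space)
  next
    case 2
    have "exp (-1) \<le> exp (- ?n * (\<epsilon> / (18 * D)) ^ ?k)" using 2 le by simp
    moreover have "1 / 3 \<le> exp (-1 :: real)" using exp_le by (simp add: exp_minus field_simps)
    ultimately have "1 - 3 * exp (- ?n * (\<epsilon> / (18 * D)) ^ ?k) \<le> 0" by linarith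
    then show ?thesis by (intro bexI[of _ "{}"]) auto
  next
    case 3
    have "prob Bad \<le> (\<Sum>l\<in>{1..L}. prob (\<Union>S\<in>Pow (labels (2 ^ l)). bad l S))"
      unfolding Bad_def using bad(1) by (intro measure_UNION_le sets.finite_UN) auto
    also have "\<dots> \<le> (\<Sum>l\<in>{1..L}. exp (- \<kappa>) * (1 / 2) ^ l)"
    proof (rule sum_mono)
      fix l assume l: "l \<in> {1..L}"
      let ?S = "Pow (labels (2 ^ l)) :: ('k \<Rightarrow> int) set set"
      have "prob (\<Union>S\<in>?S. bad l S) \<le> (\<Sum>S\<in>?S. prob (bad l S))"
        using bad(1) by (intro measure_UNION_le) auto
      also have "\<dots> \<le> (\<Sum>S\<in>?S. exp (- 2 * ?n * (e l)\<^sup>2))" by (intro sum_mono bad(2))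
      also have "\<dots> = 2 ^ (2 ^ l) ^ ?k * exp (- 2 * ?n * (e l)\<^sup>2)"
        by (simp add: card_Pow card_labels)
      also have "\<dots> \<le> exp (- \<kappa>) * (1 / 2) ^ l"
        unfolding \<kappa>_def e_def using 3 l dim by (intro level_tail_bound) (auto simp: \<kappa>_def)
      finally show "prob (\<Union>S\<in>?S. bad l S) \<le> exp (- \<kappa>) * (1 / 2) ^ l" .
    qed
    also have "\<dots> \<le> exp (- \<kappa>) * 1"
    proof -
      have "(\<Sum>l\<in>{1..L}. (1 / 2 :: real) ^ l) = 1 - (1 / 2) ^ L" by (induction L) auto
      then show ?thesis unfolding sum_distrib_left[symmetric] by (intro mult_left_mono) auto
    qed
    also have "\<dots> \<le> 3 * exp (- ?n * (\<epsilon> / (18 * D)) ^ ?k)"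
    proof -
      have "exp (- \<kappa>) \<le> exp (- ?n * (\<epsilon> / (18 * D)) ^ ?k)" using le[OF 3(2)] by simp
      then show ?thesis using exp_gt_zero[of "- ?n * (\<epsilon> / (18 * D)) ^ ?k"] by linarith
    qed
    finally have "1 - 3 * exp (- ?n * (\<epsilon> / (18 * D)) ^ ?k) \<le> prob (space ?M - Bad)"
      using prob_compl[OF Bad] by linarith
    then show ?thesis using good Bad by (intro bexI[of _ "space ?M - Bad"]) auto
  qed
qed

section \<open>The confidence level\<close>

text \<open>
  The function under the infimum is continuous in \<open>t\<close> and tends to \<open>0\<close>, so the infimum satisfies the closed form of the
  inequality. It is positive because at \<open>t = 0\<close> the sum counts the distinct decisions, of which
  there is at least one, while \<open>\<beta> / c < 1\<close>.
\<close>

lemma conf_b_attained: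
  assumes N: "1 \<le> N" and \<beta>: "0 < \<beta>" "\<beta> < 1" and c: "1 \<le> c"
  shows "0 < conf_b N x \<beta> c"
    and "(\<Sum>y\<in>x ` {1..N}. exp (- conf_b N x \<beta> c * real (mult_at N x y))) \<le> \<beta> / c"
proof -
  define f where "f t = (\<Sum>y\<in>x ` {1..N}. exp (- t * real (mult_at N x y)))" for t
  define S where "S = {t. 0 < t \<and> f t < \<beta> / c}"
  let ?m = "real (card (x ` {1..N}))"
  have m: "1 \<le> ?m" using N by (simp add: Suc_le_eq card_gt_0_iff)
  have b: "conf_b N x \<beta> c = Inf S" by (simp add: conf_b_def S_def f_def)
  \<comment> \<open>The sum is at most \<open>?m * exp (- t)\<close>, and \<open>exp t > t\<close>, so \<open>t = ?m * c / \<beta>\<close> is large enough.\<close>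
  have "?m * c / \<beta> \<in> S"
  proof -
    let ?t = "?m * c / \<beta>"
    have t: "0 < ?t" using m \<beta> c by (intro divide_pos_pos mult_pos_pos) auto
    have "f ?t \<le> (\<Sum>y\<in>x ` {1..N}. exp (- ?t))"
      unfolding f_def
    proof (rule sum_mono)
      fix y assume "y \<in> x ` {1..N}"
      then have "1 \<le> real (mult_at N x y)" using mult_at_pos[of y x N] by simp
      then have "?t * 1 \<le> ?t * real (mult_at N x y)" using t by (intro mult_left_mono) auto
      then show "exp (- ?t * real (mult_at N x y)) \<le> exp (- ?t)" by simp
    qed
    also have "\<dots> = ?m / exp ?t" by (simp add: exp_minus divide_inverse)
    also have "\<dots> < ?m / ?t"
    proof (rule divide_strict_left_mono)
      show "?t < exp ?t" using exp_ge_add_one_self[of ?t] by linarith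
      show "0 < ?m" using m by simp
      show "0 < exp ?t * ?t" using t by (intro mult_pos_pos) auto
    qed
    also have "\<dots> = \<beta> / c" using N \<beta> c by (simp add: field_simps)
    finally show ?thesis using t by (simp add: S_def)
  qed
  then have S: "S \<noteq> {}" by auto
  have bdd: "bdd_below S" by (rule bdd_belowI[of _ 0]) (simp add: S_def)
  have "closed {t. f t \<le> \<beta> / c}"
    unfolding f_def by (intro closed_Collect_le continuous_intros)
  then have "closure S \<subseteq> {t. f t \<le> \<beta> / c}" by (intro closure_minimal) (auto simp: S_def)
  then have le: "f (Inf S) \<le> \<beta> / c" using closure_contains_Inf[OF S bdd] by auto
  then show "(\<Sum>y\<in>x ` {1..N}. exp (- conf_b N x \<beta> c * real (mult_at N x y))) \<le> \<beta> / c"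
    by (simp add: b f_def)
  have "0 \<le> Inf S" using S by (intro cInf_greatest) (auto simp: S_def)
  moreover have "Inf S \<noteq> 0"
  proof
    assume "Inf S = 0"
    with le have "?m \<le> \<beta> / c" by (simp add: f_def)
    also have "\<dots> < 1" using \<beta> c by (simp add: divide_less_eq)
    finally show False using m by simp
  qed
  ultimately show "0 < conf_b N x \<beta> c" by (simp add: b)
qed

section \<open>Interpolated measures and ambiguity sets\<close>

lemma interpolation_at_data:
  fixes \<Xi> :: "(real ^ 'k) set" and X :: "'x set"
  assumes "is_interpolation X dX \<Xi> p N x s c1 Phat"
    and s: "s \<in> {1..N} \<rightarrow> \<Xi>" and y: "y \<in> x ` {1..N}" "y \<in> X"
  shows "Phat y = empirical \<Xi> N x s y"
proof -
  obtain w :: "'x \<Rightarrow> 'x \<Rightarrow> real" where w: "\<forall>y\<in>x ` {1..N}. \<forall>z\<in>X. 0 \<le> w y z"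
    "\<forall>z\<in>X. (\<Sum>y\<in>x ` {1..N}. w y z) = 1" "\<forall>y\<in>x ` {1..N}. w y y = 1"
    "\<forall>z\<in>X. Phat z = mixture \<Xi> (x ` {1..N}) (\<lambda>y. w y z) (empirical \<Xi> N x s)"
    using assms(1) unfolding is_interpolation_def by (elim conjE exE)
  have zero: "w y' y = 0" if "y' \<in> x ` {1..N}" "y' \<noteq> y" for y'
  proof -
    have "w y y = 1" using w(3) y(1) by blast
    moreover have "(\<Sum>i\<in>x ` {1..N}. w i y) = 1" using w(2) y(2) by blast
    ultimately have "(\<Sum>i\<in>x ` {1..N} - {y}. w i y) = 0"
      using sum.remove[OF _ y(1), of "\<lambda>i. w i y"] by simp
    then have "\<forall>i\<in>x ` {1..N} - {y}. w i y = 0"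
      using w(1) y(2) by (subst (asm) sum_nonneg_eq_0_iff) auto
    then show ?thesis using that by blast
  qed
  have "mixture \<Xi> (x ` {1..N}) (\<lambda>i. w i y) (empirical \<Xi> N x s) = empirical \<Xi> N x s y"
  proof (rule mixture_single)
    show "w y y = 1" using w(3) y(1) by blast
    show "sets (empirical \<Xi> N x s i) = sets (restrict_space borel \<Xi>)" for i using s by (rule sets_empirical)
  qed (use y zero in auto)
  then show ?thesis using w(4) y(2) by simp
qed

lemma interpolation_borel_probs:
  fixes \<Xi> :: "(real ^ 'k) set" and X :: "'x set"
  assumes "is_interpolation X dX \<Xi> p N x s c1 Phat"
    and s: "s \<in> {1..N} \<rightarrow> \<Xi>" and z: "z \<in> X"
  shows "Phat z \<in> borel_probs \<Xi>"
proof -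
  obtain w :: "'x \<Rightarrow> 'x \<Rightarrow> real" where w: "\<forall>y\<in>x ` {1..N}. \<forall>z\<in>X. 0 \<le> w y z"
    "\<forall>z\<in>X. (\<Sum>y\<in>x ` {1..N}. w y z) = 1"
    "\<forall>z\<in>X. Phat z = mixture \<Xi> (x ` {1..N}) (\<lambda>y. w y z) (empirical \<Xi> N x s)"
    using assms(1) unfolding is_interpolation_def by (elim conjE exE)
  have "mixture \<Xi> (x ` {1..N}) (\<lambda>y. w y z) (empirical \<Xi> N x s) \<in> borel_probs \<Xi>"
  proof (rule mixture_borel_probs)
    show "empirical \<Xi> N x s y \<in> borel_probs \<Xi>" if "y \<in> x ` {1..N}" for y
      using s that by (rule empirical_borel_probs)
  qed (use w z in auto)
  then show ?thesis using w(3) z by simp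
qed

lemma nearest_le_covering_radius:
  assumes metric: "Metric_space X dX" and x: "\<And>n. n \<in> {1..N} \<Longrightarrow> x n \<in> X" and z: "z \<in> X"
  shows "ennreal (Min (dX z ` x ` {1..N})) \<le> covering_radius X dX N x"
  unfolding covering_radius_def
proof (rule INF_greatest)
  interpret Metric_space X dX by fact
  fix r assume "r \<in> {r. 0 < r \<and> X \<subseteq> (\<Union>y\<in>x ` {1..N}. mcball y r)}"
  then obtain y where y: "y \<in> x ` {1..N}" "z \<in> mcball y r" using z by blast
  then have "Min (dX z ` x ` {1..N}) \<le> dX z y" by (intro Min_le) auto
  also have "\<dots> \<le> r" using y(2) by (simp add: commute)
  finally show "ennreal (Min (dX z ` x ` {1..N})) \<le> ennreal r" by (rule ennreal_leI)
qed

text \<open>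
  The deterministic part: the radius covers the interpolation error, the variation of \<open>Q\<close> up to the nearest
  decision of the data, and the error \<open>\<epsilon>\<close> of the empirical measure there.
\<close>

lemma interpolation_error:
  fixes \<Xi> :: "(real ^ 'k) set"
  assumes metric: "Metric_space X dX" and p: "1 \<le> p" and \<Xi>: "bounded \<Xi>"
    and Q: "\<And>z. z \<in> X \<Longrightarrow> Q z \<in> borel_probs \<Xi>"
    and c2: "0 \<le> c2" and lip: "\<And>z y. z \<in> X \<Longrightarrow> y \<in> X \<Longrightarrow> wdist p (Q z) (Q y) \<le> ennreal (c2 * dX z y)"
    and x: "\<And>n. n \<in> {1..N} \<Longrightarrow> x n \<in> X" and s: "s \<in> {1..N} \<rightarrow> \<Xi>"
    and interp: "is_interpolation X dX \<Xi> p N x s c1 Phat"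
    and emp: "\<And>y. y \<in> x ` {1..N} \<Longrightarrow> wdist p (empirical \<Xi> N x s y) (Q y) \<le> ennreal \<epsilon>"
    and z: "z \<in> X"
  shows "wdist p (Q z) (Phat z) \<le> ennreal (c1 + c2) * covering_radius X dX N x + ennreal \<epsilon>"
proof -
  interpret Metric_space X dX by fact
  let ?m = "Min (dX z ` x ` {1..N})"
  have c1: "0 \<le> c1" and "\<exists>y\<in>x ` {1..N}. dX z y = ?m \<and> wdist p (Phat z) (Phat y) \<le> ennreal (c1 * ?m)"
    using interp z unfolding is_interpolation_def by blast+
  then obtain y where y: "y \<in> x ` {1..N}" "dX z y = ?m" "wdist p (Phat z) (Phat y) \<le> ennreal (c1 * ?m)"
    by blast
  have yX: "y \<in> X" using y(1) x by auto
  have m: "0 \<le> ?m" using y(2) nonneg[of z y] by simp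
  let ?e = "empirical \<Xi> N x s y"
  have Py: "Phat y = ?e" using interp s y(1) yX by (rule interpolation_at_data)
  have Pz: "Phat z \<in> borel_probs \<Xi>" using interp s z by (rule interpolation_borel_probs)
  have e: "?e \<in> borel_probs \<Xi>" using s y(1) by (rule empirical_borel_probs)
  have "wdist p (Q z) (Phat z) \<le> wdist p (Q z) ?e + wdist p (Phat z) ?e"
    by (rule wdist_triangle[OF p \<Xi> Q[OF z] e Pz])
  also have "\<dots> \<le> (wdist p (Q z) (Q y) + wdist p ?e (Q y)) + wdist p (Phat z) ?e"
    by (intro add_right_mono wdist_triangle[OF p \<Xi> Q[OF z] Q[OF yX] e])
  also have "\<dots> \<le> (ennreal (c2 * ?m) + ennreal \<epsilon>) + ennreal (c1 * ?m)"
    using lip[OF z yX] emp[OF y(1)] y(2,3) by (intro add_mono) (auto simp: Py)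
  also have "\<dots> = ennreal (c1 + c2) * ennreal ?m + ennreal \<epsilon>"
    using c1 c2 m by (simp add: ennreal_plus ennreal_mult distrib_right add_ac)
  also have "\<dots> \<le> ennreal (c1 + c2) * covering_radius X dX N x + ennreal \<epsilon>"
    by (intro add_right_mono mult_left_mono nearest_le_covering_radius[OF metric _ z] x) auto
  finally show ?thesis .
qed

theorem theorem1:
  fixes X :: "(real ^ 'd) set" and \<Xi> :: "(real ^ 'k) set"
    and dX :: "real ^ 'd \<Rightarrow> real ^ 'd \<Rightarrow> real"
    and h :: "real ^ 'd \<Rightarrow> real ^ 'k \<Rightarrow> ereal"
    and Q :: "real ^ 'd \<Rightarrow> (real ^ 'k) measure"
    and p c2 :: real
  assumes metric: "Metric_space X dX"
    and p: "1 \<le> p"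
    and Q: "\<forall>x\<in>X. Q x \<in> borel_probs \<Xi>"
    and X: "compact X" "bounded X"
    and \<Xi>: "compact \<Xi>" "bounded \<Xi>"
    and h_bounded: "\<exists>B::real. \<forall>x\<in>X. \<forall>s\<in>\<Xi>. \<bar>h x s\<bar> \<le> ereal B"
    and h_lipschitz: "\<forall>x\<in>X. \<exists>cp>0. \<forall>s1\<in>\<Xi>. \<forall>s2\<in>\<Xi>.
          \<bar>h x s1 - h x s2\<bar> \<le> ereal (cp * pnorm p (s1 - s2))"
    and c2: "0 \<le> c2"
    and Q_lipschitz: "\<forall>x\<in>X. \<forall>y\<in>X. wdist p (Q x) (Q y) \<le> ennreal (c2 * dX x y)"
    and dim: "3 \<le> CARD('k)"
  shows "\<exists>c3>0. \<exists>c4>0.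
    \<forall>(N::nat) (x :: nat \<Rightarrow> real ^ 'd) (c1 :: (nat \<Rightarrow> real ^ 'k) \<Rightarrow> real)
      (Phat :: (nat \<Rightarrow> real ^ 'k) \<Rightarrow> real ^ 'd \<Rightarrow> (real ^ 'k) measure) (\<beta>::real)
      (r :: (nat \<Rightarrow> real ^ 'k) \<Rightarrow> ennreal).
      1 \<le> N \<longrightarrow> (\<forall>n\<in>{1..N}. x n \<in> X) \<longrightarrow>
      (\<forall>s\<in>space (sample_law N x Q). is_interpolation X dX \<Xi> p N x s (c1 s) (Phat s)) \<longrightarrow>
      0 < \<beta> \<longrightarrow> \<beta> < 1 \<longrightarrow>
      (\<forall>s. r s = ennreal (c1 s + c2) * covering_radius X dX N x
                 + ennreal ((conf_b N x \<beta> c3 / c4) powr (1 / real CARD('k)))) \<longrightarrow>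
      (\<exists>E\<in>sets (sample_law N x Q).
         E \<subseteq> {s \<in> space (sample_law N x Q). \<forall>z\<in>X. Q z \<in> ambiguity_set \<Xi> p (r s) (Phat s z)} \<and>
         measure (sample_law N x Q) E \<ge> 1 - \<beta>)"
proof -
  obtain B where B: "0 < B" "\<And>s. s \<in> \<Xi> \<Longrightarrow> norm s < B"
    using \<Xi>(2) by (metis bounded_pos_less)
  then have box: "\<bar>s $ i\<bar> < B" if "s \<in> \<Xi>" for s i
    using component_le_norm_cart[of s i] that by (meson le_less_trans)
  define D where "D = 2 * B * real CARD('k)"
  \<comment> \<open>With this constant, \<open>(\<epsilon> / (18 * D)) ^ CARD('k) = c4 * \<epsilon> ^ CARD('k)\<close>, which equals \<open>b\<close> for the
    radius chosen below.\<close>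
  define c4 where "c4 = (1 / (18 * D)) ^ CARD('k)"
  have D: "0 < D" using B by (simp add: D_def)
  have c4: "0 < c4" using D by (simp add: c4_def)
  show ?thesis
  proof (rule exI[of _ 3], intro exI[of _ c4] conjI allI impI)
    show "0 < c4" by (rule c4)
    fix N :: nat and x :: "nat \<Rightarrow> real ^ 'd" and c1 :: "(nat \<Rightarrow> real ^ 'k) \<Rightarrow> real"
      and Phat :: "(nat \<Rightarrow> real ^ 'k) \<Rightarrow> real ^ 'd \<Rightarrow> (real ^ 'k) measure"
      and \<beta> :: real and r :: "(nat \<Rightarrow> real ^ 'k) \<Rightarrow> ennreal"
    assume N: "1 \<le> N" and x: "\<forall>n\<in>{1..N}. x n \<in> X"
      and interp: "\<forall>s\<in>space (sample_law N x Q). is_interpolation X dX \<Xi> p N x s (c1 s) (Phat s)"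
      and \<beta>: "0 < \<beta>" "\<beta> < 1"
      and r: "\<forall>s. r s = ennreal (c1 s + c2) * covering_radius X dX N x
                 + ennreal ((conf_b N x \<beta> 3 / c4) powr (1 / real CARD('k)))"
    let ?M = "sample_law N x Q" and ?Y = "x ` {1..N}"
    define b where "b = conf_b N x \<beta> 3"
    define \<epsilon> where "\<epsilon> = (b / c4) powr (1 / real CARD('k))"
    have b: "0 < b" "(\<Sum>y\<in>?Y. exp (- b * real (mult_at N x y))) \<le> \<beta> / 3"
      using conf_b_attained[OF N \<beta>, of 3] by (simp_all add: b_def)
    have \<epsilon>: "0 < \<epsilon>" using b c4 by (simp add: \<epsilon>_def)
    have "\<epsilon> ^ CARD('k) = b / c4"
      using b c4 by (simp add: \<epsilon>_def powr_power)
    then have scale: "(\<epsilon> / (18 * D)) ^ CARD('k) = b"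
      using D by (simp add: c4_def power_divide field_simps)
    have Qx: "Q (x n) \<in> borel_probs \<Xi>" if "n \<in> {1..N}" for n using Q x that by blast
    interpret prob_space ?M using Qx by (rule prob_space_sample_law)
    have "\<forall>y\<in>?Y. \<exists>E\<in>events. E \<subseteq> {s \<in> space ?M. wdist p (empirical \<Xi> N x s y) (Q y) \<le> ennreal \<epsilon>}
        \<and> prob E \<ge> 1 - 3 * exp (- b * real (mult_at N x y))"
    proof
      fix y assume y: "y \<in> ?Y"
      have exponent: "- b * real (mult_at N x y)
          = - real (mult_at N x y) * (\<epsilon> / (18 * (2 * B * real CARD('k)))) ^ CARD('k)"
        using scale by (simp add: D_def)
      show "\<exists>E\<in>events. E \<subseteq> {s \<in> space ?M. wdist p (empirical \<Xi> N x s y) (Q y) \<le> ennreal \<epsilon>}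
        \<and> prob E \<ge> 1 - 3 * exp (- b * real (mult_at N x y))"
        unfolding exponent
        by (rule empirical_concentration) (rule p B(1) dim y \<epsilon> | erule box | erule Qx)+
    qed
    then have "\<forall>y\<in>?Y. \<exists>E. E \<in> events \<and> E \<subseteq> {s \<in> space ?M. wdist p (empirical \<Xi> N x s y) (Q y) \<le> ennreal \<epsilon>}
        \<and> prob E \<ge> 1 - 3 * exp (- b * real (mult_at N x y))"
      unfolding Bex_def .
    then have "\<exists>E. \<forall>y\<in>?Y. E y \<in> events \<and> E y \<subseteq> {s \<in> space ?M. wdist p (empirical \<Xi> N x s y) (Q y) \<le> ennreal \<epsilon>}
        \<and> prob (E y) \<ge> 1 - 3 * exp (- b * real (mult_at N x y))"
      by (rule bchoice)
    then obtain E where "\<forall>y\<in>?Y. E y \<in> events \<and> E y \<subseteq> {s \<in> space ?M. wdist p (empirical \<Xi> N x s y) (Q y) \<le> ennreal \<epsilon>}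
        \<and> prob (E y) \<ge> 1 - 3 * exp (- b * real (mult_at N x y))" ..
    then have E: "\<And>y. y \<in> ?Y \<Longrightarrow> E y \<in> events"
      "\<And>y. y \<in> ?Y \<Longrightarrow> E y \<subseteq> {s \<in> space ?M. wdist p (empirical \<Xi> N x s y) (Q y) \<le> ennreal \<epsilon>}"
      "\<And>y. y \<in> ?Y \<Longrightarrow> prob (E y) \<ge> 1 - 3 * exp (- b * real (mult_at N x y))"
      by blast+
    \<comment> \<open>The events are chosen before \<open>z\<close>, and only finitely many are intersected.\<close>
    define F where "F = (\<Union>y\<in>?Y. space ?M - E y)"
    have F: "F \<in> events" unfolding F_def using E(1) by (intro sets.finite_UN) auto
    have "prob F \<le> (\<Sum>y\<in>?Y. prob (space ?M - E y))"
      unfolding F_def using E(1) by (intro measure_UNION_le) auto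
    also have "\<dots> \<le> (\<Sum>y\<in>?Y. 3 * exp (- b * real (mult_at N x y)))"
    proof (rule sum_mono)
      fix y assume y: "y \<in> ?Y"
      show "prob (space ?M - E y) \<le> 3 * exp (- b * real (mult_at N x y))"
        using prob_compl[OF E(1)[OF y]] E(3)[OF y] by linarith
    qed
    also have "\<dots> \<le> \<beta>" using b(2) by (simp add: sum_distrib_left[symmetric])
    finally have "1 - \<beta> \<le> prob (space ?M - F)" using prob_compl[OF F] by simp
    moreover have "space ?M - F \<subseteq> {s \<in> space ?M. \<forall>z\<in>X. Q z \<in> ambiguity_set \<Xi> p (r s) (Phat s z)}"
    proof (intro subsetI CollectI conjI ballI)
      fix s z assume s: "s \<in> space ?M - F" and z: "z \<in> X"
      have sM: "s \<in> space ?M" using s by simp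
      have supp: "s \<in> {1..N} \<rightarrow> \<Xi>" using Qx sM by (rule sample_in_support)
      have "wdist p (Q z) (Phat s z) \<le> ennreal (c1 s + c2) * covering_radius X dX N x + ennreal \<epsilon>"
      proof (rule interpolation_error[OF metric p \<Xi>(2) _ c2 _ _ supp _ _ z])
        show "is_interpolation X dX \<Xi> p N x s (c1 s) (Phat s)" using interp sM by blast
        show "wdist p (empirical \<Xi> N x s y) (Q y) \<le> ennreal \<epsilon>" if "y \<in> ?Y" for y
          using s sM E(2)[OF that] that by (auto simp: F_def)
      qed (use Q Q_lipschitz x in auto)
      then show "Q z \<in> ambiguity_set \<Xi> p (r s) (Phat s z)"
        using Q z r by (simp add: ambiguity_set_def \<epsilon>_def b_def)
    qed auto
    ultimately show "\<exists>E\<in>sets ?M.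
         E \<subseteq> {s \<in> space ?M. \<forall>z\<in>X. Q z \<in> ambiguity_set \<Xi> p (r s) (Phat s z)} \<and>
         measure ?M E \<ge> 1 - \<beta>"
      using F by (intro bexI[of _ "space ?M - F"]) auto
  qed simp
qed

end
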